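(* Let $\beta>0$, let $\hat{\mathbf L}$, $\hat{\mathbf C}$ be estimators of $\mathbf L$, $\mathbf C$, and set $\sigma^2=\mathbb E_{\mathbf X}\|\hat{\mathbf C}(\mathbf X)\|_{1\to2}^2$ and $L=2\beta\sigma^2$. Let $T\ge 1$ and let $\hat{\boldsymbol\lambda}_T\in\mathbb R^M_+$ be the output of an arbitrary black-box optimizer $\mathcal O(\hat F,\sigma^2,L,T)$ (as defined in the context, with associated $\alpha>0$ and bound $\Psi_\alpha(T,\sigma^2,L)$) applied to $\hat F$ on the basis of $T$ i.i.d. samples from $\mathbb P_{\mathbf X}$. Then the randomized classifier $\hat\pi_{\hat{\boldsymbol\lambda}_T}$ satisfies $$\mathbf E\sqrt{\sum_{j\in[M]}\big(\mathcal C_j(\hat\pi_{\hat{\boldsymbol\lambda}_T})\big)_+^2}\;\le\;\Psi_\alpha(T,\sigma^2,L)+\hat\Delta_{\mathrm{constr}} .$$ Furthermore, for any randomized prediction function $\pi$ with $\mathcal C_j(\pi)\le0$ for all $j\in[M]$, $$\mathbf E[\mathcal R(\hat\pi_{\hat{\boldsymbol\lambda}_T})]\le \mathcal R(\pi)+\sqrt{\mathbf E\big(\|\hat{\boldsymbol\lambda}_T\|+\alpha\sigma\big)^2}\;\Psi_\alpha(T,\sigma^2,L)+2\,\mathbf E[\hat\Delta_{\mathrm{loss}}]+\mathbf E\big[\hat\Delta_{\mathrm{constr}}\|\hat{\boldsymbol\lambda}_T\|\big]+\frac{2\log(|\mathcal A|)}{\beta}.$$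
   Context: Setting. $\mathcal X$ is a feature space, $\mathbf X\sim\mathbb P_{\mathbf X}$ is a random element of $\mathcal X$, $\mathcal A$ is a finite set of predictions, $M\ge0$ an integer, $[M]=\{1,\dots,M\}$. There are (measurable) functions $\ell:\mathcal X\times\mathcal A\to\mathbb R$ (loss) and $c_j:\mathcal X\times\mathcal A\to\mathbb R$, $j\in[M]$ (costs). Put $\mathbf L(\mathbf x)=(\ell(\mathbf x,a))_{a\in\mathcal A}\in\mathbb R^{|\mathcal A|}$ and $\mathbf C(\mathbf x)=(c_j(\mathbf x,a))_{j\in[M],a\in\mathcal A}\in\mathbb R^{M\times|\mathcal A|}$. A randomized prediction function (randomized classifier) is a Markov kernel $\pi$ from $\mathcal X$ to $\mathcal A$, with $\boldsymbol\pi(\mathbf x)=(\pi(a\mid\mathbf x))_{a\in\mathcal A}$. Its risk and costs are $\mathcal R(\pi)=\mathbb E_{\mathbf X}[\sum_{a}\ell(\mathbf X,a)\pi(a\mid\mathbf X)]$ and $\mathcal C_j(\pi)=\mathbb E_{\mathbf X}[\sum_a c_j(\mathbf X,a)\pi(a\mid\mathbf X)]$. Estimators. $\hat{\mathbf L}:\mathcal X\to\mathbb R^{|\mathcal A|}$ and $\hat{\mathbf C}:\mathcal X\to\mathbb R^{M\times|\mathcal A|}$ are given (estimated) functions, independent of the unlabeled sample used below; $\mathbb E_{\mathbf X}$ (and $\mathbb E$) is expectation over $\mathbf X\sim\mathbb P_{\mathbf X}$ only, with the estimators held fixed. All expectations appearing are assumed finite. Errors: $\hat\Delta_{\mathrm{loss}}=\mathbb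 E\|\mathbf L(\mathbf X)-\hat{\mathbf L}(\mathbf X)\|_\infty$, $\hat\Delta_{\mathrm{constr}}^2=\mathbb E\|\mathbf C(\mathbf X)-\hat{\mathbf C}(\mathbf X)\|_{1\to2}^2$, $\hat\Delta_{\mathrm{constr}}\ge0$. Notation. $\|\cdot\|$ is the Euclidean norm; $\|\mathbf A\|_{p\to q}=\sup\{\|\mathbf A\mathbf w\|_q:\|\mathbf w\|_p=1\}$; $(a)_+=\max\{a,0\}$, componentwise for vectors; $\mathbb R^M_+$ is the nonnegative orthant. For $\mathbf w\in\mathbb R^m$, $\mathrm{LSE}_\beta(\mathbf w)=\beta^{-1}\log(\sum_{j=1}^m e^{\beta w_j})$. For $\boldsymbol\lambda\in\mathbb R^M_+$: $\hat F(\boldsymbol\lambda)=\mathbb E_{\mathbf X}[\mathrm{LSE}_\beta(-\hat{\mathbf L}(\mathbf X)-\hat{\mathbf C}(\mathbf X)^\top\boldsymbol\lambda)]$, and $\hat\pi_{\boldsymbol\lambda}(a\mid\mathbf x)\propto\exp\big(\beta(-\hat{\mathbf L}(\mathbf x)-\hat{\mathbf C}(\mathbf x)^\top\boldsymbol\lambda)_a\big)$, $a\in\mathcal A$ (normalized to sum to one over $\mathcal A$). Black-box optimizer. For $L,\sigma>0$, let $\mathcal F_{L,\sigma^2}$ be the class of functions $F(\boldsymbol\lambda)=\mathbb E_P[f(\boldsymbol\lambda,\mathbf X)]$, with $P$ a probability distribution on $\mathcal X$ and $f:\mathbb R_+^M\times\mathcal X\to\mathbb R$, such that: (1) $\boldsymbol\lambda\mapsto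 f(\boldsymbol\lambda,\mathbf x)$ is convex for every $\mathbf x$; (2) $\|\nabla F(\boldsymbol\lambda)-\nabla F(\boldsymbol\lambda')\|\le L\|\boldsymbol\lambda-\boldsymbol\lambda'\|$ on $\mathbb R^M_+$; (3) $\sup_{\boldsymbol\lambda\in\mathbb R^M_+}\mathbb E_P\|\nabla_{\boldsymbol\lambda}f(\boldsymbol\lambda,\mathbf X)-\nabla F(\boldsymbol\lambda)\|^2\le\sigma^2$. For $F\in\mathcal F_{L,\sigma^2}$ and $T\ge1$, a black-box optimizer $\mathcal O(F,\sigma^2,L,T)$ is any procedure that, on the basis of i.i.d. samples $\mathbf X_1,\dots,\mathbf X_T$ from $P$, returns $\hat{\boldsymbol\lambda}_T\in\mathbb R_+^M$ satisfying, for some $\alpha>0$, $$\mathbf E\left\|\frac{\hat{\boldsymbol\lambda}_T-\big(\hat{\boldsymbol\lambda}_T-\alpha\nabla F(\hat{\boldsymbol\lambda}_T)\big)_+}{\alpha}\right\|^2\le\Psi_\alpha^2(T,\sigma^2,L),$$ where $\Psi_\alpha(T,\sigma^2,L)\ge0$ is some quantity controlling the norm of the gradient mapping. Here $P=\mathbb P_{\mathbf X}$ and $f(\boldsymbol\lambda,\mathbf x)=\mathrm{LSE}_\beta(-\hat{\mathbf L}(\mathbf x)-\hat{\mathbf C}(\mathbf x)^\top\boldsymbol\lambda)$. The bold $\mathbf E$ denotes expectation over the randomness of the procedure (in particular the sample $\mathbf X_1,\dots,\mathbf X_T$), with the estimators held fixed. *)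

theory Defs
  imports "HOL-Probability.Probability"
begin

text \<open>
  The number \<open>M \<ge> 0\<close> of constraints is an ordinary natural number, so vectors in \<open>\<real>\<^sup>M\<close> are functions
  on \<open>{1..M}\<close> (extensional, as in \<open>PiE\<close> and \<open>PiM\<close>), with Euclidean norm \<open>L2_set _ {1..M}\<close>.
  Predictions form a finite type \<open>'a\<close>; a matrix in \<open>\<real>\<^sup>M\<^sup>\<times>\<^sup>A\<close> is the family of its rows
  \<open>A j :: real ^ 'a\<close>, \<open>j \<in> {1..M}\<close>.  The distribution of the features is \<open>P\<close>.
\<close>

definition orthant :: "nat \<Rightarrow> (nat \<Rightarrow> real) set" where
  "orthant M = ({1..M} \<rightarrow>\<^sub>E {0..})"

definition orthant_space :: "nat \<Rightarrow> (nat \<Rightarrow> real) measure" where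
  "orthant_space M = (\<Pi>\<^sub>M j\<in>{1..M}. restrict_space borel {0..})"

lemma space_orthant_space: "space (orthant_space M) = orthant M"
  by (simp add: orthant_space_def orthant_def space_PiM space_restrict_space)

definition norm_1_2 :: "nat \<Rightarrow> (nat \<Rightarrow> real ^ 'a) \<Rightarrow> real" where
  "norm_1_2 M A =
    (SUP w \<in> {w :: real ^ 'a. (\<Sum>a\<in>UNIV. \<bar>w $ a\<bar>) = 1}. L2_set (\<lambda>j. A j \<bullet> w) {1..M})"

definition LSE :: "real \<Rightarrow> real ^ 'a \<Rightarrow> real" where
  "LSE \<beta> w = ln (\<Sum>a\<in>UNIV. exp (\<beta> * w $ a)) / \<beta>"

text \<open>
  Objectives live on the orthant only, so differentiability is Frechet differentiability within it.
  The limit refers to the product topology on \<open>nat \<Rightarrow> real\<close>, which on extensional functions is the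
  Euclidean one.  At every point of the orthant the gradient is unique.
\<close>

definition has_gradient ::
    "nat \<Rightarrow> ((nat \<Rightarrow> real) \<Rightarrow> real) \<Rightarrow> (nat \<Rightarrow> real) \<Rightarrow> (nat \<Rightarrow> real) \<Rightarrow> bool" where
  "has_gradient M F g u \<longleftrightarrow> g \<in> extensional {1..M} \<and>
    ((\<lambda>v. (F v - F u - (\<Sum>j\<in>{1..M}. g j * (v j - u j))) / L2_set (\<lambda>j. v j - u j) {1..M})
      \<longlongrightarrow> 0) (at u within orthant M)"

definition grad :: "nat \<Rightarrow> ((nat \<Rightarrow> real) \<Rightarrow> real) \<Rightarrow> (nat \<Rightarrow> real) \<Rightarrow> nat \<Rightarrow> real" where
  "grad M F u = (THE g. has_gradient M F g u)"

definition gradient_mapping ::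
    "nat \<Rightarrow> real \<Rightarrow> ((nat \<Rightarrow> real) \<Rightarrow> real) \<Rightarrow> (nat \<Rightarrow> real) \<Rightarrow> nat \<Rightarrow> real" where
  "gradient_mapping M \<alpha> F u = (\<lambda>j\<in>{1..M}. (u j - max (u j - \<alpha> * grad M F u j) 0) / \<alpha>)"

definition mean_objective :: "'x measure \<Rightarrow> ((nat \<Rightarrow> real) \<Rightarrow> 'x \<Rightarrow> real) \<Rightarrow> (nat \<Rightarrow> real) \<Rightarrow> real"
  where "mean_objective P f u = (\<integral>x. f u x \<partial>P)"

text \<open>
  Membership in \<open>\<F>\<^bsub>L,\<sigma>\<^sup>2\<^esub>\<close> of the objective represented by \<open>(P, f)\<close>; \<open>s2\<close> stands for \<open>\<sigma>\<^sup>2\<close>.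
  The degenerate values \<open>L = 0\<close> and \<open>s2 = 0\<close> are admitted: they occur when \<open>M = 0\<close> or when the
  estimated cost matrix vanishes almost surely.
\<close>

definition smooth_objective ::
    "nat \<Rightarrow> real \<Rightarrow> real \<Rightarrow> 'x measure \<Rightarrow> ((nat \<Rightarrow> real) \<Rightarrow> 'x \<Rightarrow> real) \<Rightarrow> bool" where
  "smooth_objective M L s2 P f \<longleftrightarrow>
     prob_space P \<and>
     (\<forall>u\<in>orthant M. integrable P (f u)) \<and>
     (\<forall>x\<in>space P. \<forall>u\<in>orthant M. \<forall>v\<in>orthant M. \<forall>t\<in>{0..1}.
        f (\<lambda>j\<in>{1..M}. (1 - t) * u j + t * v j) x \<le> (1 - t) * f u x + t * f v x) \<and>
     (\<forall>x\<in>space P. \<forall>u\<in>orthant M. \<exists>g. has_gradient M (\<lambda>v. f v x) g u) \<and>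
     (\<forall>u\<in>orthant M. \<exists>g. has_gradient M (mean_objective P f) g u) \<and>
     (\<forall>u\<in>orthant M. \<forall>v\<in>orthant M.
        L2_set (\<lambda>j. grad M (mean_objective P f) u j - grad M (mean_objective P f) v j) {1..M}
          \<le> L * L2_set (\<lambda>j. u j - v j) {1..M}) \<and>
     (\<forall>u\<in>orthant M.
        (\<integral>\<^sup>+x. ennreal ((L2_set (\<lambda>j. grad M (\<lambda>v. f v x) u j
                                    - grad M (mean_objective P f) u j) {1..M})\<^sup>2) \<partial>P)
          \<le> ennreal s2)"

text \<open>
  A procedure maps the sample \<open>(X\<^sub>1, \<dots>, X\<^sub>T)\<close>, possibly using internal randomness, to a point of the
  orthant; it is a Markov kernel \<open>opt\<close>.  \<open>output_law\<close> is the law of its output on an i.i.d. sample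
  from \<open>P\<close>, so that integration against it is expectation over sample and internal randomness.
\<close>

definition output_law ::
    "'x measure \<Rightarrow> nat \<Rightarrow> ((nat \<Rightarrow> 'x) \<Rightarrow> (nat \<Rightarrow> real) measure) \<Rightarrow> (nat \<Rightarrow> real) measure" where
  "output_law P T opt = (\<Pi>\<^sub>M i\<in>{1..T}. P) \<bind> opt"

text \<open>
  The guarantee is only demanded when the objective is in the class; hence to use it for a concrete
  objective one has to prove membership.
\<close>

definition black_box_optimizer ::
    "nat \<Rightarrow> 'x measure \<Rightarrow> ((nat \<Rightarrow> real) \<Rightarrow> 'x \<Rightarrow> real) \<Rightarrow> real \<Rightarrow> real \<Rightarrow> nat \<Rightarrow>
     real \<Rightarrow> (real \<Rightarrow> nat \<Rightarrow> real \<Rightarrow> real \<Rightarrow> real) \<Rightarrow>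
     ((nat \<Rightarrow> 'x) \<Rightarrow> (nat \<Rightarrow> real) measure) \<Rightarrow> bool" where
  "black_box_optimizer M P f s2 L T \<alpha> \<Psi> opt \<longleftrightarrow>
     opt \<in> (\<Pi>\<^sub>M i\<in>{1..T}. P) \<rightarrow>\<^sub>M prob_algebra (orthant_space M) \<and>
     \<alpha> > 0 \<and> \<Psi> \<alpha> T s2 L \<ge> 0 \<and>
     (smooth_objective M L s2 P f \<longrightarrow>
       (\<integral>\<^sup>+u. ennreal ((L2_set (gradient_mapping M \<alpha> (mean_objective P f) u) {1..M})\<^sup>2)
          \<partial>output_law P T opt) \<le> ennreal ((\<Psi> \<alpha> T s2 L)\<^sup>2))"

definition randomized_classifier :: "'x measure \<Rightarrow> ('x \<Rightarrow> 'a measure) \<Rightarrow> bool" where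
  "randomized_classifier P \<pi> \<longleftrightarrow> \<pi> \<in> P \<rightarrow>\<^sub>M prob_algebra (count_space UNIV)"

text \<open>Used both for the risk (\<open>h\<close> the loss) and for the \<open>j\<close>-th cost (\<open>h = c j\<close>).\<close>

definition expected_score :: "'x measure \<Rightarrow> ('x \<Rightarrow> 'a :: finite \<Rightarrow> real) \<Rightarrow> ('x \<Rightarrow> 'a measure) \<Rightarrow> real"
  where "expected_score P h \<pi> = (\<integral>x. (\<Sum>a\<in>UNIV. h x a * measure (\<pi> x) {a}) \<partial>P)"

text \<open>The vector \<open>- L(x) - C(x)\<^sup>T u\<close>.\<close>

definition neg_lagrangian ::
    "nat \<Rightarrow> ('x \<Rightarrow> real ^ 'a) \<Rightarrow> ('x \<Rightarrow> nat \<Rightarrow> real ^ 'a) \<Rightarrow> (nat \<Rightarrow> real) \<Rightarrow> 'x \<Rightarrow> real ^ 'a" where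
  "neg_lagrangian M L C u x = - L x - (\<Sum>j\<in>{1..M}. u j *\<^sub>R C x j)"

definition gibbs_classifier ::
    "nat \<Rightarrow> real \<Rightarrow> ('x \<Rightarrow> real ^ 'a) \<Rightarrow> ('x \<Rightarrow> nat \<Rightarrow> real ^ 'a) \<Rightarrow> (nat \<Rightarrow> real) \<Rightarrow> 'x \<Rightarrow> 'a measure"
  where
  "gibbs_classifier M \<beta> L C u x = point_measure UNIV (\<lambda>a. ennreal
     (exp (\<beta> * neg_lagrangian M L C u x $ a) / (\<Sum>b\<in>UNIV. exp (\<beta> * neg_lagrangian M L C u x $ b))))"

definition lse_objective ::
    "nat \<Rightarrow> real \<Rightarrow> ('x \<Rightarrow> real ^ 'a) \<Rightarrow> ('x \<Rightarrow> nat \<Rightarrow> real ^ 'a) \<Rightarrow> (nat \<Rightarrow> real) \<Rightarrow> 'x \<Rightarrow> real" where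
  "lse_objective M \<beta> L C u x = LSE \<beta> (neg_lagrangian M L C u x)"

end

theory Submission
  imports Defs
begin

text \<open>
  Write \<open>gibbs u x\<close> for the softmax of the scores \<open>w u x = - Lhat x - (Chat x)\<^sup>T u\<close>, i.e. for the Gibbs classifier
  at the multiplier \<open>u\<close>, and \<open>F\<close> for the mean of \<open>LSE \<beta> (w u x)\<close>.  Since softmax is the gradient of
  log-sum-exp, the gradient of \<open>F\<close> at \<open>u\<close> is minus the vector of estimated costs of \<open>gibbs u\<close>: a multiplier at
  which the gradient mapping \<open>G\<close> is small is one at which the estimated constraints almost hold and
  complementary slackness almost holds.

  The guarantee of the optimizer becomes available once \<open>F\<close> is known to be smooth.  Smoothness
  rests on two facts about softmax: the subgradient inequality for \<open>LSE\<close> (nonnegativity of a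
  Kullback-Leibler divergence, \<open>LSE_subgradient\<close>) and its Lipschitz continuity from the maximum norm to
  the l1 norm (a weak Pinsker inequality, \<open>softmax_l1_Lipschitz\<close>).  Together they bound the linearisation
  error of each \<open>LSE \<beta> (w u x)\<close> between \<open>0\<close> and a multiple of \<open>(norm_1_2 M (Chat x))\<^sup>2\<close> times the squared
  displacement (\<open>f_expansion\<close>), a bound that survives integration and so identifies the gradient of \<open>F\<close>.

  For a fixed multiplier, coordinatewise inequalities for the gradient mapping give
  \<open>(- \<nabla>F)\<^sub>+ \<le> \<bar>G\<bar>\<close> and \<open>u \<bullet> \<nabla>F \<le> (\<parallel>u\<parallel> + \<alpha> \<sigma>) \<parallel>G\<parallel>\<close>.  The first bounds the constraint violation
  (\<open>constraint_violation\<close>); the second, combined with the fact that \<open>gibbs u x\<close> minimises the estimated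
  Lagrangian up to \<open>ln |A| / \<beta>\<close>, bounds the risk (\<open>risk_bound\<close>).  Passing from estimated to true losses and
  costs introduces \<open>\<Delta>loss\<close> and \<open>\<Delta>constr\<close>.  The theorem follows by averaging over the output of the
  optimizer and applying the Cauchy-Schwarz inequality to the products with \<open>\<parallel>G\<parallel>\<close>.
\<close>

section \<open>The operator norm from l1 to l2\<close>

lemma l1_norm_axis: "(\<Sum>b\<in>UNIV. \<bar>axis (a::'a::finite) (1::real) $ b\<bar>) = 1"
  by (simp add: axis_def if_distrib[of abs] cong: if_cong)

lemma norm_1_2_upper:
  fixes A :: "nat \<Rightarrow> real ^ 'a::finite"
  assumes "(\<Sum>a\<in>UNIV. \<bar>w $ a\<bar>) = 1"
  shows "L2_set (\<lambda>j. A j \<bullet> w) {1..M} \<le> norm_1_2 M A"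
  unfolding norm_1_2_def
proof (rule cSUP_upper)
  show "bdd_above ((\<lambda>w. L2_set (\<lambda>j. A j \<bullet> w) {1..M}) ` {w. (\<Sum>a\<in>UNIV. \<bar>w $ a\<bar>) = 1})"
  proof (rule bdd_aboveI2)
    fix w :: "real ^ 'a" assume "w \<in> {w. (\<Sum>a\<in>UNIV. \<bar>w $ a\<bar>) = 1}"
    then have "norm w \<le> 1" using norm_le_l1_cart[of w] by simp
    then have "\<bar>A j \<bullet> w\<bar> \<le> norm (A j)" for j
      using Cauchy_Schwarz_ineq2[of "A j" w] mult_left_le[of "norm w" "norm (A j)"] by simp
    then show "L2_set (\<lambda>j. A j \<bullet> w) {1..M} \<le> (\<Sum>j\<in>{1..M}. norm (A j))"
      by (intro order_trans[OF L2_set_le_sum_abs] sum_mono)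
  qed
qed (use assms in auto)

lemma norm_1_2_nonneg: "0 \<le> norm_1_2 M (A :: nat \<Rightarrow> real ^ 'a::finite)"
  using norm_1_2_upper[OF l1_norm_axis, of A _ M] L2_set_nonneg order_trans by blast

lemma L2_set_le_norm_1_2:
  fixes A :: "nat \<Rightarrow> real ^ 'a::finite"
  shows "L2_set (\<lambda>j. A j \<bullet> w) {1..M} \<le> norm_1_2 M A * (\<Sum>a\<in>UNIV. \<bar>w $ a\<bar>)"
proof (cases "(\<Sum>a\<in>UNIV. \<bar>w $ a\<bar>) = 0")
  case True
  then have "w = 0" by (simp add: vec_eq_iff sum_nonneg_eq_0_iff)
  then show ?thesis by (simp add: L2_set_def)
next
  case False
  define s where "s = (\<Sum>a\<in>UNIV. \<bar>w $ a\<bar>)"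
  have s: "s > 0" using False by (simp add: s_def sum_nonneg less_le)
  have "(\<Sum>a\<in>UNIV. \<bar>((1/s) *\<^sub>R w) $ a\<bar>) = 1"
    using s by (simp add: abs_mult s_def[symmetric] flip: sum_divide_distrib)
  from norm_1_2_upper[OF this, of A M]
  have "s * L2_set (\<lambda>j. A j \<bullet> ((1/s) *\<^sub>R w)) {1..M} \<le> s * norm_1_2 M A"
    using s by simp
  moreover have "s * L2_set (\<lambda>j. A j \<bullet> ((1/s) *\<^sub>R w)) {1..M} = L2_set (\<lambda>j. A j \<bullet> w) {1..M}"
    using s by (simp add: L2_set_right_distrib)
  ultimately show ?thesis by (simp add: s_def mult.commute)
qed

text \<open>The columns of \<open>A\<close> are the images of the unit vectors, so each has Euclidean norm at most
  \<open>norm_1_2 M A\<close>.\<close>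

lemma abs_transpose_le_norm_1_2:
  fixes A :: "nat \<Rightarrow> real ^ 'a::finite"
  shows "\<bar>\<Sum>j\<in>{1..M}. u j * A j $ a\<bar> \<le> norm_1_2 M A * L2_set u {1..M}"
proof -
  have "\<bar>\<Sum>j\<in>{1..M}. u j * A j $ a\<bar> \<le> (\<Sum>j\<in>{1..M}. \<bar>u j\<bar> * \<bar>A j $ a\<bar>)"
    by (rule order_trans[OF sum_abs]) (simp add: abs_mult)
  also have "\<dots> \<le> L2_set u {1..M} * L2_set (\<lambda>j. A j $ a) {1..M}"
    by (rule L2_set_mult_ineq)
  also have "L2_set (\<lambda>j. A j $ a) {1..M} \<le> norm_1_2 M A"
    using norm_1_2_upper[OF l1_norm_axis, of A a M] by (simp add: inner_axis)
  finally show ?thesis by (simp add: mult.commute mult_right_mono)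
qed

section \<open>Softmax and log-sum-exp\<close>

definition softmax :: "real \<Rightarrow> real ^ 'a \<Rightarrow> real ^ 'a::finite" where
  "softmax \<beta> w = (\<chi> a. exp (\<beta> * w $ a) / (\<Sum>b\<in>UNIV. exp (\<beta> * w $ b)))"

lemma sum_exp_pos: "(\<Sum>b\<in>UNIV. exp (h (b::'a::finite))) > (0::real)"
  by (intro sum_pos) auto

lemma softmax_pos: "softmax \<beta> w $ a > 0"
  by (simp add: softmax_def sum_exp_pos)

lemma softmax_nonneg: "softmax \<beta> w $ a \<ge> 0"
  using softmax_pos less_imp_le by blast

lemma sum_softmax: "(\<Sum>a\<in>UNIV. softmax \<beta> w $ a) = 1"
  using sum_exp_pos[of "\<lambda>b. \<beta> * w $ b"] by (simp add: softmax_def flip: sum_divide_distrib)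

lemma ln_softmax:
  assumes "\<beta> > 0" shows "ln (softmax \<beta> w $ a) = \<beta> * (w $ a - LSE \<beta> w)"
  using sum_exp_pos[of "\<lambda>b. \<beta> * w $ b"] assms
  by (simp add: softmax_def LSE_def ln_div right_diff_distrib)

text \<open>The gradient of \<open>LSE\<close> is the softmax; the inequality is nonnegativity of the Kullback-Leibler
  divergence of \<open>softmax \<beta> w\<close> from \<open>softmax \<beta> w'\<close>.\<close>

lemma LSE_subgradient:
  fixes w w' :: "real ^ 'a::finite"
  assumes "\<beta> > 0"
  shows "LSE \<beta> w + softmax \<beta> w \<bullet> (w' - w) \<le> LSE \<beta> w'"
proof -
  let ?p = "\<lambda>a. softmax \<beta> w $ a" and ?q = "\<lambda>a. softmax \<beta> w' $ a"
  have "?p a * (ln (?q a) - ln (?p a)) \<le> ?q a - ?p a" for a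
    using ln_le_minus_one[of "?q a / ?p a"] softmax_pos[of \<beta> w a] softmax_pos[of \<beta> w' a]
    by (simp add: ln_div field_simps)
  then have "(\<Sum>a\<in>UNIV. ?p a * (ln (?q a) - ln (?p a))) \<le> (\<Sum>a\<in>UNIV. ?q a - ?p a)"
    by (intro sum_mono)
  also have "\<dots> = 0" by (simp add: sum_subtractf sum_softmax)
  finally have "0 \<ge> (\<Sum>a\<in>UNIV. ?p a * (ln (?q a) - ln (?p a)))" .
  also have "(\<Sum>a\<in>UNIV. ?p a * (ln (?q a) - ln (?p a))) =
     (\<Sum>a\<in>UNIV. \<beta> * (?p a * (w' $ a - w $ a)) + \<beta> * (LSE \<beta> w - LSE \<beta> w') * ?p a)"
    by (intro sum.cong) (simp_all add: ln_softmax[OF assms] algebra_simps)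
  also have "\<dots> = \<beta> * (softmax \<beta> w \<bullet> (w' - w) + LSE \<beta> w - LSE \<beta> w')"
    unfolding sum.distrib sum_distrib_left[symmetric]
    by (simp add: inner_vec_def sum_softmax algebra_simps)
  finally show ?thesis using assms by (simp add: mult_le_0_iff)
qed

lemma component_le_LSE:
  assumes "\<beta> > 0" shows "w $ a \<le> LSE \<beta> (w :: real ^ 'a::finite)"
proof -
  have "exp (\<beta> * w $ a) \<le> (\<Sum>b\<in>UNIV. exp (\<beta> * w $ b))"
    by (rule member_le_sum) auto
  then have "\<beta> * w $ a \<le> ln (\<Sum>b\<in>UNIV. exp (\<beta> * w $ b))"
    by (simp add: ln_ge_iff sum_exp_pos)
  then show ?thesis using assms by (simp add: LSE_def field_simps)
qed

text \<open>The upper bound is the subgradient inequality read at the zero vector, where \<open>LSE\<close> is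
  \<open>ln |A| / \<beta>\<close>.\<close>

lemma LSE_le_softmax:
  fixes w :: "real ^ 'a::finite"
  assumes "\<beta> > 0" shows "LSE \<beta> w \<le> softmax \<beta> w \<bullet> w + ln (real CARD('a)) / \<beta>"
  using LSE_subgradient[OF assms, of w 0] by (simp add: LSE_def)

text \<open>\<open>LSE \<beta> w\<close> separates the two sides: it is at least the largest score, hence at least every average
  of scores.\<close>

lemma softmax_almost_maximal:
  fixes w q :: "real ^ 'a::finite"
  assumes "\<beta> > 0" "\<And>a. q $ a \<ge> 0" "(\<Sum>a\<in>UNIV. q $ a) = 1"
  shows "q \<bullet> w \<le> softmax \<beta> w \<bullet> w + ln (real CARD('a)) / \<beta>"
proof -
  have "q \<bullet> w \<le> (\<Sum>a\<in>UNIV. q $ a * LSE \<beta> w)"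
    unfolding inner_vec_def by (auto intro!: sum_mono mult_left_mono component_le_LSE assms)
  also have "\<dots> = LSE \<beta> w" by (simp add: assms(3) flip: sum_distrib_right)
  finally show ?thesis using LSE_le_softmax[OF assms(1), of w] by simp
qed

lemma square_diff_le_ln:
  fixes p q :: real
  assumes "p > 0" "q > 0"
  shows "(p - q)\<^sup>2 / (p + q) \<le> (p - q) * (ln p - ln q)"
proof -
  have *: "(p - q)\<^sup>2 / (p + q) \<le> (p - q) * (ln p - ln q)" if "p > 0" "q > 0" "q \<le> p" for p q :: real
  proof -
    have "(p - q) / (p + q) \<le> (p - q) / p" using that by (intro divide_left_mono) auto
    also have "\<dots> \<le> ln p - ln q"
      using ln_le_minus_one[of "q / p"] that by (simp add: ln_div field_simps)
    finally have "(p - q) * ((p - q) / (p + q)) \<le> (p - q) * (ln p - ln q)"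
      using that by (intro mult_left_mono) auto
    then show ?thesis by (simp add: power2_eq_square)
  qed
  show ?thesis
    using *[of p q] *[of q p] assms by (cases "q \<le> p") (auto simp: power2_commute add.commute algebra_simps)
qed

text \<open>The symmetrised divergence of two softmax vectors equals \<open>\<beta> (p - q) \<bullet> (w - w')\<close>, because the
  normalising constants cancel against \<open>\<Sum>(p - q) = 0\<close>; and by Cauchy-Schwarz it dominates half the
  squared l1 distance (a weak form of Pinsker's inequality).\<close>

lemma softmax_l1_Lipschitz:
  fixes w w' :: "real ^ 'a::finite"
  assumes "\<beta> > 0" and K: "\<And>a. \<bar>w $ a - w' $ a\<bar> \<le> K"
  shows "(\<Sum>a\<in>UNIV. \<bar>(softmax \<beta> w - softmax \<beta> w') $ a\<bar>) \<le> 2 * \<beta> * K"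
proof -
  let ?p = "\<lambda>a. softmax \<beta> w $ a" and ?q = "\<lambda>a. softmax \<beta> w' $ a"
  define D where "D = (\<Sum>a\<in>UNIV. \<bar>?p a - ?q a\<bar>)"
  have pos: "?p a > 0" "?q a > 0" for a by (rule softmax_pos)+
  have pq: "?p a + ?q a > 0" for a using pos[of a] by simp
  have "D = (\<Sum>a\<in>UNIV. (\<bar>?p a - ?q a\<bar> / sqrt (?p a + ?q a)) * sqrt (?p a + ?q a))"
    unfolding D_def by (intro sum.cong) (simp_all add: pq[THEN less_imp_neq, symmetric])
  then have "D\<^sup>2 \<le> (\<Sum>a\<in>UNIV. (\<bar>?p a - ?q a\<bar> / sqrt (?p a + ?q a))\<^sup>2) * (\<Sum>a\<in>UNIV. (sqrt (?p a + ?q a))\<^sup>2)"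
    by (simp only: Cauchy_Schwarz_ineq_sum)
  also have "(\<Sum>a\<in>UNIV. (sqrt (?p a + ?q a))\<^sup>2) = 2"
    using pq by (simp add: less_imp_le sum.distrib sum_softmax)
  also have "(\<Sum>a\<in>UNIV. (\<bar>?p a - ?q a\<bar> / sqrt (?p a + ?q a))\<^sup>2) \<le> (\<Sum>a\<in>UNIV. (?p a - ?q a) * (ln (?p a) - ln (?q a)))"
    using pq square_diff_le_ln[OF pos] by (intro sum_mono) (simp add: power_divide less_imp_le)
  also have "\<dots> = (\<Sum>a\<in>UNIV. \<beta> * ((?p a - ?q a) * (w $ a - w' $ a)) + (\<beta> * (LSE \<beta> w' - LSE \<beta> w)) * (?p a - ?q a))"
    by (intro sum.cong) (simp_all add: ln_softmax[OF assms(1)] algebra_simps)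
  also have "\<dots> = \<beta> * (\<Sum>a\<in>UNIV. (?p a - ?q a) * (w $ a - w' $ a))"
    by (simp add: sum.distrib sum_subtractf sum_softmax flip: sum_distrib_left)
  also have "(\<Sum>a\<in>UNIV. (?p a - ?q a) * (w $ a - w' $ a)) \<le> (\<Sum>a\<in>UNIV. \<bar>?p a - ?q a\<bar> * K)"
  proof (rule sum_mono)
    fix a
    have "(?p a - ?q a) * (w $ a - w' $ a) \<le> \<bar>?p a - ?q a\<bar> * \<bar>w $ a - w' $ a\<bar>"
      by (metis abs_ge_self abs_mult)
    also have "\<dots> \<le> \<bar>?p a - ?q a\<bar> * K" by (intro mult_left_mono K) simp
    finally show "(?p a - ?q a) * (w $ a - w' $ a) \<le> \<bar>?p a - ?q a\<bar> * K" .
  qed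
  also have "\<dots> = D * K" by (simp add: D_def sum_distrib_right)
  finally have "D * D \<le> (2 * \<beta> * K) * D" using assms by (simp add: power2_eq_square algebra_simps)
  moreover have "D \<ge> 0" by (simp add: D_def sum_nonneg)
  moreover have "K \<ge> 0" using K[of undefined] by linarith
  ultimately have "D \<le> 2 * \<beta> * K"
    using assms(1) by (cases "D = 0") (auto dest: mult_right_le_imp_le)
  then show ?thesis by (simp add: D_def)
qed

section \<open>Gradients within the orthant\<close>

text \<open>The Frechet quotient is at most \<open>K\<close> times the Euclidean distance, and that distance tends to \<open>0\<close> in the
  product topology because it depends on finitely many coordinates only.\<close>

lemma has_gradientI_quadratic:
  assumes "g \<in> extensional {1..M}"
    and q: "\<And>v. v \<in> orthant M \<Longrightarrow>
      \<bar>F v - F u - (\<Sum>j\<in>{1..M}. g j * (v j - u j))\<bar> \<le> K * (L2_set (\<lambda>j. v j - u j) {1..M})\<^sup>2"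
  shows "has_gradient M F g u"
  unfolding has_gradient_def
proof (intro conjI assms(1))
  let ?N = "\<lambda>v. L2_set (\<lambda>j. v j - u j) {1..M}"
  have c: "((\<lambda>v. v j) \<longlongrightarrow> u j) (at u within orthant M)" for j
    using continuous_on_product_coordinates[of j]
    unfolding continuous_on_def by (blast intro: tendsto_within_subset)
  have "((\<lambda>v. K * ?N v) \<longlongrightarrow> K * ?N u) (at u within orthant M)"
    unfolding L2_set_def by (intro tendsto_intros c)
  then have lim: "((\<lambda>v. K * ?N v) \<longlongrightarrow> 0) (at u within orthant M)"
    by (simp add: L2_set_def)
  show "((\<lambda>v. (F v - F u - (\<Sum>j\<in>{1..M}. g j * (v j - u j))) / ?N v) \<longlongrightarrow> 0) (at u within orthant M)"
  proof (rule Lim_null_comparison[OF _ lim])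
    have "norm ((F v - F u - (\<Sum>j\<in>{1..M}. g j * (v j - u j))) / ?N v) \<le> K * ?N v"
      if "v \<in> orthant M" for v
    proof (cases "?N v = 0")
      case False
      then have "?N v > 0" by (simp add: less_le)
      then show ?thesis using q[OF that] by (simp add: divide_le_eq power2_eq_square mult.assoc)
    qed simp
    then show "\<forall>\<^sub>F v in at u within orthant M.
        norm ((F v - F u - (\<Sum>j\<in>{1..M}. g j * (v j - u j))) / ?N v) \<le> K * ?N v"
      by (simp add: eventually_at_filter)
  qed
qed

text \<open>From every point of the orthant each positive coordinate direction is feasible, and these
  directions determine the gradient.\<close>

lemma has_gradient_unique:
  assumes u: "u \<in> orthant M" and g: "has_gradient M F g u" and h: "has_gradient M F h u"
  shows "g = h"
proof (rule extensionalityI)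
  show "g \<in> extensional {1..M}" "h \<in> extensional {1..M}"
    using g h by (auto simp: has_gradient_def)
  fix i assume i: "i \<in> {1..M}"
  define line where "line t = u(i := u i + t)" for t :: real
  have line: "filterlim line (at u within orthant M) (at_right 0)"
    unfolding filterlim_at
  proof
    show "\<forall>\<^sub>F t in at_right 0. line t \<in> orthant M \<and> line t \<noteq> u"
      using eventually_at_right_less[of "0::real"]
    proof eventually_elim
      case (elim t)
      then show ?case using u i
        by (auto simp: line_def orthant_def PiE_iff extensional_def fun_eq_iff intro!: add_nonneg_nonneg)
    qed
    have "continuous_on UNIV line"
    proof (rule continuous_on_coordinatewise_then_product)
      show "continuous_on UNIV (\<lambda>t. line t j)" for j
        by (cases "j = i") (auto simp: line_def intro!: continuous_intros)
    qed
    then have "(line \<longlongrightarrow> line 0) (at 0)" by (simp add: continuous_on_def)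
    then show "(line \<longlongrightarrow> u) (at_right 0)"
      by (simp add: line_def tendsto_within_subset[OF _ subset_UNIV])
  qed
  let ?R = "\<lambda>g v. (F v - F u - (\<Sum>j\<in>{1..M}. g j * (v j - u j))) / L2_set (\<lambda>j. v j - u j) {1..M}"
  have "((\<lambda>v. ?R g v - ?R h v) \<longlongrightarrow> 0 - 0) (at u within orthant M)"
    using g h unfolding has_gradient_def by (intro tendsto_diff) auto
  from filterlim_compose[OF this line]
  have "((\<lambda>t. ?R g (line t) - ?R h (line t)) \<longlongrightarrow> 0) (at_right 0)" by simp
  moreover have "\<forall>\<^sub>F t in at_right 0. ?R g (line t) - ?R h (line t) = h i - g i"
    using eventually_at_right_less[of "0::real"]
  proof eventually_elim
    case (elim t)
    have d: "(\<lambda>j. line t j - u j) = (\<lambda>j. if j = i then t else 0)" by (auto simp: line_def)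
    have "(\<Sum>j\<in>{1..M}. k j * (line t j - u j)) = k i * t" for k
      using i by (simp add: fun_cong[OF d] if_distrib cong: if_cong)
    moreover have "L2_set (\<lambda>j. line t j - u j) {1..M} = t"
      unfolding d L2_set_def using i elim by (simp add: if_distrib[of "\<lambda>x. x\<^sup>2"] cong: if_cong)
    ultimately show ?case using elim by (simp add: diff_divide_distrib[symmetric] field_simps)
  qed
  ultimately have "((\<lambda>t. h i - g i) \<longlongrightarrow> 0) (at_right (0::real))"
    by (rule Lim_transform_eventually)
  then show "g i = h i"
    by (simp add: tendsto_const_iff)
qed

lemma grad_eq: "u \<in> orthant M \<Longrightarrow> has_gradient M F g u \<Longrightarrow> grad M F u = g"
  unfolding grad_def by (blast intro: the_equality has_gradient_unique)

section \<open>The gradient mapping\<close>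

text \<open>If the projection onto the half-line is inactive, the gradient mapping is \<open>g\<close>
  itself; if it is active, \<open>g > 0\<close> and the gradient mapping is \<open>u / \<alpha>\<close>.\<close>

lemma gradient_mapping_real:
  fixes u g \<alpha> :: real
  assumes "\<alpha> > 0" "u \<ge> 0"
  defines "G \<equiv> (u - max (u - \<alpha> * g) 0) / \<alpha>"
  shows neg_part_le_gradient_mapping: "max (- g) 0 \<le> \<bar>G\<bar>"
    and complementarity_gradient_mapping: "u * g \<le> (u + \<alpha> * \<bar>g\<bar>) * \<bar>G\<bar>"
proof -
  consider (inactive) "\<alpha> * g \<le> u" "G = g" | (active) "u < \<alpha> * g" "G = u / \<alpha>" "g > 0"
  proof (cases "\<alpha> * g \<le> u")
    case False
    then have "0 < \<alpha> * g" using assms by linarith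
    then show thesis using False that(2) assms(1) by (simp add: G_def zero_less_mult_iff)
  qed (use assms(1) in \<open>simp add: G_def that(1)\<close>)
  then have "max (- g) 0 \<le> \<bar>G\<bar> \<and> u * g \<le> (u + \<alpha> * \<bar>g\<bar>) * \<bar>G\<bar>"
  proof cases
    case inactive
    have "u * g \<le> u * \<bar>g\<bar>" using assms(2) by (intro mult_left_mono) auto
    moreover have "0 \<le> \<alpha> * \<bar>g\<bar> * \<bar>g\<bar>" using assms(1) by simp
    ultimately show ?thesis using inactive by (simp add: distrib_right)
  next
    case active
    then show ?thesis using assms by (simp add: field_simps)
  qed
  then show "max (- g) 0 \<le> \<bar>G\<bar>" "u * g \<le> (u + \<alpha> * \<bar>g\<bar>) * \<bar>G\<bar>" by auto
qed

section \<open>Integral inequalities\<close>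

lemma Cauchy_Schwarz_integral:
  fixes f g :: "'x \<Rightarrow> real"
  assumes [measurable]: "f \<in> borel_measurable P" "g \<in> borel_measurable P"
    and f: "integrable P (\<lambda>x. (f x)\<^sup>2)" and g: "integrable P (\<lambda>x. (g x)\<^sup>2)"
  shows integrable_mult_of_squares: "integrable P (\<lambda>x. f x * g x)"
    and integral_mult_le_sqrt:
      "(\<integral>x. f x * g x \<partial>P) \<le> sqrt (\<integral>x. (f x)\<^sup>2 \<partial>P) * sqrt (\<integral>x. (g x)\<^sup>2 \<partial>P)"
proof -
  show fg: "integrable P (\<lambda>x. f x * g x)"
  proof (rule Bochner_Integration.integrable_bound)
    show "integrable P (\<lambda>x. (f x)\<^sup>2 + (g x)\<^sup>2)" using f g by simp
    have "\<bar>s * t\<bar> \<le> s\<^sup>2 + t\<^sup>2" for s t :: real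
      using sum_squares_bound[of "\<bar>s\<bar>" "\<bar>t\<bar>"] mult_nonneg_nonneg[of "\<bar>s\<bar>" "\<bar>t\<bar>"]
      by (simp only: abs_mult power2_abs) linarith
    then show "AE x in P. norm (f x * g x) \<le> norm ((f x)\<^sup>2 + (g x)\<^sup>2)" by simp
  qed simp
  have "(\<integral>\<^sup>+x. ennreal \<bar>f x\<bar> * ennreal \<bar>g x\<bar> \<partial>P)\<^sup>2
      \<le> (\<integral>\<^sup>+x. (ennreal \<bar>f x\<bar>)\<^sup>2 \<partial>P) * (\<integral>\<^sup>+x. (ennreal \<bar>g x\<bar>)\<^sup>2 \<partial>P)"
    by (rule Cauchy_Schwarz_nn_integral) auto
  also have "(\<integral>\<^sup>+x. ennreal \<bar>f x\<bar> * ennreal \<bar>g x\<bar> \<partial>P) = ennreal (\<integral>x. \<bar>f x * g x\<bar> \<partial>P)"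
    using integrable_abs[OF fg]
    by (subst nn_integral_eq_integral[symmetric]) (simp_all add: abs_mult ennreal_mult)
  also have "(\<integral>\<^sup>+x. (ennreal \<bar>f x\<bar>)\<^sup>2 \<partial>P) = ennreal (\<integral>x. (f x)\<^sup>2 \<partial>P)"
    using f by (subst nn_integral_eq_integral[symmetric]) (simp_all add: ennreal_power)
  also have "(\<integral>\<^sup>+x. (ennreal \<bar>g x\<bar>)\<^sup>2 \<partial>P) = ennreal (\<integral>x. (g x)\<^sup>2 \<partial>P)"
    using g by (subst nn_integral_eq_integral[symmetric]) (simp_all add: ennreal_power)
  finally have "(\<integral>x. \<bar>f x * g x\<bar> \<partial>P)\<^sup>2 \<le> (\<integral>x. (f x)\<^sup>2 \<partial>P) * (\<integral>x. (g x)\<^sup>2 \<partial>P)"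
    by (simp add: ennreal_power flip: ennreal_mult)
  from real_le_rsqrt[OF this]
  have "(\<integral>x. \<bar>f x * g x\<bar> \<partial>P) \<le> sqrt (\<integral>x. (f x)\<^sup>2 \<partial>P) * sqrt (\<integral>x. (g x)\<^sup>2 \<partial>P)"
    by (simp add: real_sqrt_mult)
  moreover have "(\<integral>x. f x * g x \<partial>P) \<le> (\<integral>x. \<bar>f x * g x\<bar> \<partial>P)"
    using fg by (intro integral_mono) auto
  ultimately show "(\<integral>x. f x * g x \<partial>P) \<le> sqrt (\<integral>x. (f x)\<^sup>2 \<partial>P) * sqrt (\<integral>x. (g x)\<^sup>2 \<partial>P)" by simp
qed

lemma (in prob_space) expectation_le_sqrt_square:
  fixes f :: "'a \<Rightarrow> real"
  assumes "f \<in> borel_measurable M" "integrable M (\<lambda>x. (f x)\<^sup>2)"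
  shows "expectation f \<le> sqrt (expectation (\<lambda>x. (f x)\<^sup>2))"
  using integral_mult_le_sqrt[of f M "\<lambda>_. 1"] assms by (simp add: prob_space)

text \<open>Jensen's inequality for the Euclidean norm: with \<open>e\<close> the mean of \<open>Y\<close>,
  \<open>\<parallel>e\<parallel>\<^sup>2 = E (e \<bullet> Y) \<le> \<parallel>e\<parallel> E \<parallel>Y\<parallel>\<close>.\<close>

lemma L2_set_integral_le:
  fixes Y :: "'i \<Rightarrow> 'x \<Rightarrow> real"
  assumes Y: "\<And>j. j \<in> J \<Longrightarrow> integrable P (Y j)" and N: "integrable P N"
    and YN: "\<And>x. x \<in> space P \<Longrightarrow> L2_set (\<lambda>j. Y j x) J \<le> N x"
  shows "L2_set (\<lambda>j. \<integral>x. Y j x \<partial>P) J \<le> (\<integral>x. N x \<partial>P)"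
proof -
  define e where "e j = (\<integral>x. Y j x \<partial>P)" for j
  have "(L2_set e J)\<^sup>2 = (\<Sum>j\<in>J. e j * (\<integral>x. Y j x \<partial>P))"
    by (simp add: L2_set_def e_def sum_nonneg power2_eq_square)
  also have "\<dots> = (\<integral>x. (\<Sum>j\<in>J. e j * Y j x) \<partial>P)"
    using Y by (subst Bochner_Integration.integral_sum) auto
  also have "\<dots> \<le> (\<integral>x. L2_set e J * N x \<partial>P)"
  proof (rule integral_mono)
    fix x assume x: "x \<in> space P"
    have "(\<Sum>j\<in>J. e j * Y j x) \<le> (\<Sum>j\<in>J. \<bar>e j\<bar> * \<bar>Y j x\<bar>)"
      by (intro sum_mono) (metis abs_ge_self abs_mult)
    also have "\<dots> \<le> L2_set e J * L2_set (\<lambda>j. Y j x) J" by (rule L2_set_mult_ineq)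
    also have "\<dots> \<le> L2_set e J * N x" using YN[OF x] by (simp add: mult_left_mono)
    finally show "(\<Sum>j\<in>J. e j * Y j x) \<le> L2_set e J * N x" .
  qed (use Y N in auto)
  finally have "L2_set e J * L2_set e J \<le> L2_set e J * (\<integral>x. N x \<partial>P)"
    using N by (simp add: power2_eq_square)
  moreover have "0 \<le> (\<integral>x. N x \<partial>P)"
    using YN order_trans[OF L2_set_nonneg] by (intro integral_nonneg_AE AE_I2) blast
  ultimately have "L2_set e J \<le> (\<integral>x. N x \<partial>P)"
    using L2_set_nonneg[of e J] by (cases "L2_set e J = 0") auto
  then show ?thesis unfolding e_def .
qed

section \<open>Costs of randomized predictions\<close>

text \<open>The Gibbs classifier and its competitors enter all estimates only through their probability
  vectors, so these estimates are stated for measurable maps into the simplex.\<close>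

definition simplex_valued :: "'x measure \<Rightarrow> ('x \<Rightarrow> real ^ 'a::finite) \<Rightarrow> bool" where
  "simplex_valued P q \<longleftrightarrow> (\<forall>a. (\<lambda>x. q x $ a) \<in> borel_measurable P) \<and>
     (\<forall>x\<in>space P. (\<forall>a. 0 \<le> q x $ a) \<and> (\<Sum>a\<in>UNIV. q x $ a) = 1)"

lemma simplex_valuedD:
  assumes "simplex_valued P q"
  shows "(\<lambda>x. q x $ a) \<in> borel_measurable P"
    and "x \<in> space P \<Longrightarrow> 0 \<le> q x $ a" and "x \<in> space P \<Longrightarrow> (\<Sum>a\<in>UNIV. q x $ a) = 1"
    and "x \<in> space P \<Longrightarrow> q x $ a \<le> 1" and "x \<in> space P \<Longrightarrow> (\<Sum>a\<in>UNIV. \<bar>q x $ a\<bar>) = 1"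
proof -
  show *: "(\<lambda>x. q x $ a) \<in> borel_measurable P" "x \<in> space P \<Longrightarrow> 0 \<le> q x $ a"
    "x \<in> space P \<Longrightarrow> (\<Sum>a\<in>UNIV. q x $ a) = 1" for a
    using assms by (auto simp: simplex_valued_def)
  show "x \<in> space P \<Longrightarrow> q x $ a \<le> 1"
    using member_le_sum[of a UNIV "\<lambda>a. q x $ a"] * by auto
  show "x \<in> space P \<Longrightarrow> (\<Sum>a\<in>UNIV. \<bar>q x $ a\<bar>) = 1"
    using * by simp
qed

lemma simplex_inner_bounds:
  fixes q h :: "real ^ 'a::finite"
  assumes "\<And>a. 0 \<le> q $ a" "(\<Sum>a\<in>UNIV. q $ a) = 1" "\<And>a. \<bar>h $ a\<bar> \<le> K"
  shows "\<bar>h \<bullet> q\<bar> \<le> K"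
proof -
  have "\<bar>h \<bullet> q\<bar> \<le> (\<Sum>a\<in>UNIV. \<bar>h $ a\<bar> * q $ a)"
    unfolding inner_vec_def using assms(1) by (intro order_trans[OF sum_abs]) (simp add: abs_mult)
  also have "\<dots> \<le> (\<Sum>a\<in>UNIV. K * q $ a)" by (intro sum_mono mult_right_mono assms)
  also have "\<dots> = K" by (simp add: assms(2) flip: sum_distrib_left)
  finally show ?thesis .
qed

lemma integrable_inner_simplex:
  fixes h q :: "'x \<Rightarrow> real ^ 'a::finite"
  assumes q: "simplex_valued P q" and h: "\<And>a. integrable P (\<lambda>x. h x $ a)"
  shows "integrable P (\<lambda>x. h x \<bullet> q x)"
proof -
  have "integrable P (\<lambda>x. h x $ a * q x $ a)" for a
  proof (rule Bochner_Integration.integrable_bound[OF h[of a]])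
    show "(\<lambda>x. h x $ a * q x $ a) \<in> borel_measurable P"
      using h[of a] simplex_valuedD(1)[OF q, of a] by measurable
    show "AE x in P. norm (h x $ a * q x $ a) \<le> norm (h x $ a)"
      using simplex_valuedD(2,4)[OF q] by (auto simp: abs_mult mult_left_le)
  qed
  then show ?thesis by (simp add: inner_vec_def)
qed

text \<open>A probability vector has l1 norm one, so \<open>D x\<close> maps it to a vector of norm at most
  \<open>norm_1_2 m (D x)\<close>; averaging uses Jensen's inequality twice, for the norm and for the square.
  Applied to \<open>D = Chat\<close> this bounds gradients, applied to \<open>D = C - Chat\<close> it bounds the error made by
  estimating costs.\<close>

lemma (in prob_space) mean_cost:
  fixes D :: "'a \<Rightarrow> nat \<Rightarrow> real ^ 'b::finite"
  assumes D: "\<And>j a. j \<in> {1..m} \<Longrightarrow> (\<lambda>x. D x j $ a) \<in> borel_measurable M"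
    and sq: "integrable M (\<lambda>x. (norm_1_2 m (D x))\<^sup>2)"
  shows integrable_cost_entry: "j \<in> {1..m} \<Longrightarrow> integrable M (\<lambda>x. D x j $ a)"
    and L2_set_mean_cost_le: "simplex_valued M q \<Longrightarrow>
      L2_set (\<lambda>j. expectation (\<lambda>x. D x j \<bullet> q x)) {1..m}
        \<le> sqrt (expectation (\<lambda>x. (norm_1_2 m (D x))\<^sup>2))"
proof -
  have "(\<lambda>x. sqrt ((norm_1_2 m (D x))\<^sup>2)) \<in> borel_measurable M"
    using sq by measurable
  then have meas: "(\<lambda>x. norm_1_2 m (D x)) \<in> borel_measurable M"
    by (simp add: norm_1_2_nonneg)
  have N: "integrable M (\<lambda>x. norm_1_2 m (D x))"
    by (rule square_integrable_imp_integrable[OF meas sq])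
  have le: "expectation (\<lambda>x. norm_1_2 m (D x)) \<le> sqrt (expectation (\<lambda>x. (norm_1_2 m (D x))\<^sup>2))"
    by (rule expectation_le_sqrt_square[OF meas sq])
  \<comment> \<open>An entry is a coordinate of a column, and a column is the image of a unit vector.\<close>
  have entry: "\<bar>D x j $ a\<bar> \<le> norm_1_2 m (D x)" if "j \<in> {1..m}" for x j a
    using member_le_L2_set[of "{1..m}" j "\<lambda>j. \<bar>D x j \<bullet> axis a 1\<bar>"] that
      norm_1_2_upper[OF l1_norm_axis, of "D x" a m]
    by (simp add: inner_axis L2_set_def)
  show int: "integrable M (\<lambda>x. D x j $ a)" if "j \<in> {1..m}" for j a
    by (rule Bochner_Integration.integrable_bound[OF N D[OF that]])
      (auto simp: norm_1_2_nonneg intro: entry[OF that])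
  show "L2_set (\<lambda>j. expectation (\<lambda>x. D x j \<bullet> q x)) {1..m}
        \<le> sqrt (expectation (\<lambda>x. (norm_1_2 m (D x))\<^sup>2))" if q: "simplex_valued M q"
  proof (rule order_trans[OF L2_set_integral_le le])
    show "L2_set (\<lambda>j. D x j \<bullet> q x) {1..m} \<le> norm_1_2 m (D x)" if "x \<in> space M" for x
      using norm_1_2_upper[OF simplex_valuedD(5)[OF q that]] .
  qed (auto intro!: integrable_inner_simplex q int N)
qed

definition prob_vector :: "('x \<Rightarrow> 'a measure) \<Rightarrow> 'x \<Rightarrow> real ^ 'a::finite" where
  "prob_vector \<pi> x = (\<chi> a. measure (\<pi> x) {a})"

lemma expected_score_eq:
  "expected_score P h \<pi> = (\<integral>x. (\<chi> a. h x a) \<bullet> prob_vector \<pi> x \<partial>P)"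
  by (simp add: expected_score_def prob_vector_def inner_vec_def)

lemma simplex_valued_randomized_classifier:
  assumes "randomized_classifier P \<pi>"
  shows "simplex_valued P (prob_vector \<pi> :: 'x \<Rightarrow> real ^ 'a::finite)"
proof -
  have m: "\<pi> \<in> P \<rightarrow>\<^sub>M prob_algebra (count_space UNIV)"
    using assms by (simp add: randomized_classifier_def)
  have "(\<lambda>x. measure (\<pi> x) {a}) \<in> borel_measurable P" for a
    by (rule measurable_compose[OF m measurable_measure_prob_algebra]) simp
  moreover have "(\<Sum>a\<in>UNIV. measure (\<pi> x) {a}) = 1" if "x \<in> space P" for x
  proof -
    have s: "sets (\<pi> x) = UNIV" "prob_space (\<pi> x)"
      using measurable_space[OF m that] by (auto simp: space_prob_algebra)
    then interpret \<pi>: prob_space "\<pi> x" by simp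
    have "(\<Sum>a\<in>UNIV. measure (\<pi> x) {a}) = measure (\<pi> x) UNIV"
      by (intro \<pi>.finite_measure_eq_sum_singleton[symmetric]) (auto simp: s)
    moreover have "space (\<pi> x) = UNIV"
      using sets_eq_imp_space_eq[of "\<pi> x" "count_space UNIV"] s by simp
    ultimately show ?thesis using \<pi>.prob_space by simp
  qed
  ultimately show ?thesis by (simp add: simplex_valued_def prob_vector_def)
qed

lemma prob_vector_gibbs_classifier:
  "prob_vector (gibbs_classifier M \<beta> L C u) x = softmax \<beta> (neg_lagrangian M L C u x)"
  by (simp add: prob_vector_def gibbs_classifier_def softmax_def vec_eq_iff
      measure_point_measure_finite_if measure_def emeasure_point_measure_finite sum_nonneg)

lemma measurable_orthant_coordinate:
  "j \<in> {1..M} \<Longrightarrow> (\<lambda>u. u j) \<in> borel_measurable (orthant_space M)"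
  unfolding orthant_space_def
  by (rule measurable_compose[OF measurable_component_singleton]) (auto intro: measurable_restrict_space1)

section \<open>The dual objective\<close>

text \<open>The estimators alone determine the objective and the Gibbs classifier; the true losses and costs
  enter as parameters of the lemmas that compare them with their estimates.\<close>

locale estimated_problem = prob_space P for P :: "'x measure" +
  fixes M :: nat and \<beta> \<sigma> :: real
    and Lhat :: "'x \<Rightarrow> real ^ 'a::finite" and Chat :: "'x \<Rightarrow> nat \<Rightarrow> real ^ 'a"
  assumes \<beta>_pos: "\<beta> > 0"
    and integrable_Lhat: "\<And>a. integrable P (\<lambda>x. Lhat x $ a)"
    and measurable_Chat: "\<And>j a. j \<in> {1..M} \<Longrightarrow> (\<lambda>x. Chat x j $ a) \<in> borel_measurable P"
    and integrable_norm_sq: "integrable P (\<lambda>x. (norm_1_2 M (Chat x))\<^sup>2)"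
    and \<sigma>_nonneg: "\<sigma> \<ge> 0"
    and \<sigma>_sq: "\<sigma>\<^sup>2 = (\<integral>x. (norm_1_2 M (Chat x))\<^sup>2 \<partial>P)"
begin

abbreviation w :: "(nat \<Rightarrow> real) \<Rightarrow> 'x \<Rightarrow> real ^ 'a" where
  "w u x \<equiv> neg_lagrangian M Lhat Chat u x"

abbreviation gibbs :: "(nat \<Rightarrow> real) \<Rightarrow> 'x \<Rightarrow> real ^ 'a" where
  "gibbs u x \<equiv> softmax \<beta> (w u x)"

abbreviation f :: "(nat \<Rightarrow> real) \<Rightarrow> 'x \<Rightarrow> real" where
  "f \<equiv> lse_objective M \<beta> Lhat Chat"

abbreviation F :: "(nat \<Rightarrow> real) \<Rightarrow> real" where
  "F \<equiv> mean_objective P f"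

abbreviation opnorm :: "'x \<Rightarrow> real" where
  "opnorm x \<equiv> norm_1_2 M (Chat x)"

abbreviation distance :: "(nat \<Rightarrow> real) \<Rightarrow> (nat \<Rightarrow> real) \<Rightarrow> real" where
  "distance v u \<equiv> L2_set (\<lambda>j. v j - u j) {1..M}"

text \<open>Gradients are required to be extensional, whence the restriction to \<open>{1..M}\<close>.\<close>

definition f_gradient :: "(nat \<Rightarrow> real) \<Rightarrow> 'x \<Rightarrow> nat \<Rightarrow> real" where
  "f_gradient u x = (\<lambda>j\<in>{1..M}. - (Chat x j \<bullet> gibbs u x))"

definition F_gradient :: "(nat \<Rightarrow> real) \<Rightarrow> nat \<Rightarrow> real" where
  "F_gradient u = (\<lambda>j\<in>{1..M}. - (\<integral>x. Chat x j \<bullet> gibbs u x \<partial>P))"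

lemma neg_lagrangian_component: "w u x $ a = - Lhat x $ a - (\<Sum>j\<in>{1..M}. u j * Chat x j $ a)"
  by (simp add: neg_lagrangian_def)

lemma abs_neg_lagrangian_diff: "\<bar>w v x $ a - w u x $ a\<bar> \<le> opnorm x * distance v u"
proof -
  have "w v x $ a - w u x $ a = - (\<Sum>j\<in>{1..M}. (v j - u j) * Chat x j $ a)"
    by (simp add: neg_lagrangian_component left_diff_distrib sum_subtractf)
  then show ?thesis
    using abs_transpose_le_norm_1_2[where A = "Chat x" and u = "\<lambda>j. v j - u j" and M = M and a = a]
    by simp
qed

lemma inner_neg_lagrangian: "q \<bullet> w u x = - (Lhat x \<bullet> q) - (\<Sum>j\<in>{1..M}. u j * (Chat x j \<bullet> q))"
  by (simp add: neg_lagrangian_def inner_diff_right inner_sum_right inner_commute)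

lemma inner_gibbs_diff:
  "gibbs u x \<bullet> (w v x - w u x) = (\<Sum>j\<in>{1..M}. f_gradient u x j * (v j - u j))"
  by (simp add: inner_diff_right inner_neg_lagrangian f_gradient_def algebra_simps
      flip: sum_subtractf sum_negf)

lemma gibbs_l1_Lipschitz:
  "(\<Sum>a\<in>UNIV. \<bar>(gibbs v x - gibbs u x) $ a\<bar>) \<le> 2 * \<beta> * (opnorm x * distance v u)"
  by (rule softmax_l1_Lipschitz[OF \<beta>_pos abs_neg_lagrangian_diff])

text \<open>Two subgradient inequalities, one at each end, squeeze the linearisation error between \<open>0\<close> and
  \<open>(gibbs v - gibbs u) \<bullet> (w v - w u)\<close>.  The bound is quadratic in the displacement with
  an integrable constant, so it passes to the mean; this yields the gradient of the mean
  without differentiating under the integral sign.\<close>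

lemma f_expansion:
  "0 \<le> f v x - f u x - (\<Sum>j\<in>{1..M}. f_gradient u x j * (v j - u j))"
  "f v x - f u x - (\<Sum>j\<in>{1..M}. f_gradient u x j * (v j - u j))
     \<le> 2 * \<beta> * (opnorm x)\<^sup>2 * (distance v u)\<^sup>2"
proof -
  show "0 \<le> f v x - f u x - (\<Sum>j\<in>{1..M}. f_gradient u x j * (v j - u j))"
    using LSE_subgradient[OF \<beta>_pos, of "w u x" "w v x"]
    by (simp add: inner_gibbs_diff lse_objective_def)
  let ?K = "opnorm x * distance v u"
  have K: "0 \<le> ?K" by (simp add: norm_1_2_nonneg)
  have "f v x - f u x - gibbs u x \<bullet> (w v x - w u x) \<le> (gibbs v x - gibbs u x) \<bullet> (w v x - w u x)"
    using LSE_subgradient[OF \<beta>_pos, of "w v x" "w u x"]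
    by (simp add: lse_objective_def inner_diff_left inner_diff_right)
  also have "\<dots> \<le> (\<Sum>a\<in>UNIV. \<bar>(gibbs v x - gibbs u x) $ a\<bar> * ?K)"
    unfolding inner_vec_def
  proof (rule sum_mono)
    fix a
    have "(gibbs v x - gibbs u x) $ a \<bullet> (w v x - w u x) $ a
        \<le> \<bar>(gibbs v x - gibbs u x) $ a\<bar> * \<bar>(w v x - w u x) $ a\<bar>"
      by (metis abs_ge_self abs_mult inner_real_def)
    also have "\<dots> \<le> \<bar>(gibbs v x - gibbs u x) $ a\<bar> * ?K"
      using abs_neg_lagrangian_diff[of v x a u] by (intro mult_left_mono) auto
    finally show "(gibbs v x - gibbs u x) $ a \<bullet> (w v x - w u x) $ a
        \<le> \<bar>(gibbs v x - gibbs u x) $ a\<bar> * ?K" .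
  qed
  also have "\<dots> \<le> 2 * \<beta> * ?K * ?K"
    unfolding sum_distrib_right[symmetric] by (rule mult_right_mono[OF gibbs_l1_Lipschitz K])
  finally show "f v x - f u x - (\<Sum>j\<in>{1..M}. f_gradient u x j * (v j - u j))
     \<le> 2 * \<beta> * (opnorm x)\<^sup>2 * (distance v u)\<^sup>2"
    unfolding inner_gibbs_diff by (simp add: power2_eq_square mult_ac)
qed

lemma measurable_neg_lagrangian: "(\<lambda>x. w u x $ a) \<in> borel_measurable P"
  using measurable_Chat borel_measurable_integrable[OF integrable_Lhat]
  unfolding neg_lagrangian_component by (intro measurable) auto

lemma simplex_valued_gibbs: "simplex_valued P (gibbs u)"
  unfolding simplex_valued_def
proof (intro conjI allI ballI)
  note [measurable] = measurable_neg_lagrangian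
  show "(\<lambda>x. gibbs u x $ a) \<in> borel_measurable P" for a
    unfolding softmax_def by simp
qed (simp_all add: softmax_nonneg sum_softmax)

lemma measurable_gibbs_pair:
  "(\<lambda>(u, x). gibbs u x $ a) \<in> borel_measurable (orthant_space M \<Otimes>\<^sub>M P)"
proof -
  have 1: "(\<lambda>z. fst z j) \<in> borel_measurable (orthant_space M \<Otimes>\<^sub>M P)" if "j \<in> {1..M}" for j
    by (rule measurable_compose[OF measurable_fst measurable_orthant_coordinate[OF that]])
  have 2: "(\<lambda>z. Chat (snd z) j $ a) \<in> borel_measurable (orthant_space M \<Otimes>\<^sub>M P)" if "j \<in> {1..M}" for j a
    by (rule measurable_compose[OF measurable_snd measurable_Chat[OF that]])
  have 3: "(\<lambda>z. Lhat (snd z) $ a) \<in> borel_measurable (orthant_space M \<Otimes>\<^sub>M P)" for a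
    by (rule measurable_compose[OF measurable_snd borel_measurable_integrable[OF integrable_Lhat]])
  have [measurable]: "(\<lambda>z. w (fst z) (snd z) $ a) \<in> borel_measurable (orthant_space M \<Otimes>\<^sub>M P)" for a
    unfolding neg_lagrangian_component
    by (intro borel_measurable_diff borel_measurable_uminus borel_measurable_sum borel_measurable_times 1 2 3)
  show ?thesis
    unfolding softmax_def split_beta by simp
qed

lemma measurable_mean_score:
  assumes h: "\<And>a. (\<lambda>x. h x $ a) \<in> borel_measurable P"
  shows "(\<lambda>u. \<integral>x. h x \<bullet> gibbs u x \<partial>P) \<in> borel_measurable (orthant_space M)"
proof (rule borel_measurable_lebesgue_integral)
  have "(\<lambda>z. h (snd z) $ a) \<in> borel_measurable (orthant_space M \<Otimes>\<^sub>M P)" for a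
    by (rule measurable_compose[OF measurable_snd h])
  then show "(\<lambda>(u, x). h x \<bullet> gibbs u x) \<in> borel_measurable (orthant_space M \<Otimes>\<^sub>M P)"
    using measurable_gibbs_pair unfolding inner_vec_def inner_real_def split_beta
    by (intro borel_measurable_sum borel_measurable_times) auto
qed

lemmas integrable_Chat = integrable_cost_entry[OF measurable_Chat integrable_norm_sq]

lemma integrable_cost:
  "simplex_valued P q \<Longrightarrow> j \<in> {1..M} \<Longrightarrow> integrable P (\<lambda>x. Chat x j \<bullet> q x)"
  by (intro integrable_inner_simplex integrable_Chat)

lemma L2_set_mean_Chat_le:
  "simplex_valued P q \<Longrightarrow> L2_set (\<lambda>j. \<integral>x. Chat x j \<bullet> q x \<partial>P) {1..M} \<le> \<sigma>"
  using L2_set_mean_cost_le[OF measurable_Chat integrable_norm_sq, of q] \<sigma>_nonneg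
  by (simp flip: \<sigma>_sq)

lemma integrable_f: "integrable P (f u)"
proof (rule Bochner_Integration.integrable_bound)
  have wi: "integrable P (\<lambda>x. w u x $ a)" for a
    unfolding neg_lagrangian_component
    by (intro Bochner_Integration.integrable_diff integrable_minus integrable_Lhat
        Bochner_Integration.integrable_sum integrable_mult_right integrable_Chat)
  let ?B = "\<lambda>x. (\<Sum>a\<in>UNIV. \<bar>w u x $ a\<bar>) + ln (real CARD('a)) / \<beta>"
  show "integrable P ?B"
    by (intro Bochner_Integration.integrable_add Bochner_Integration.integrable_sum integrable_abs wi) simp
  note [measurable] = measurable_neg_lagrangian
  show "f u \<in> borel_measurable P"
    unfolding lse_objective_def LSE_def by measurable
  have "\<bar>f u x\<bar> \<le> ?B x" for x
  proof -
    have c: "\<bar>w u x $ a\<bar> \<le> (\<Sum>a\<in>UNIV. \<bar>w u x $ a\<bar>)" for a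
      by (rule member_le_sum) auto
    have "w u x \<bullet> gibbs u x \<le> (\<Sum>a\<in>UNIV. \<bar>w u x $ a\<bar>)"
      using simplex_inner_bounds[OF softmax_nonneg sum_softmax c] abs_le_D1 by blast
    then have "f u x \<le> ?B x"
      using LSE_le_softmax[OF \<beta>_pos, of "w u x"] by (simp add: lse_objective_def inner_commute)
    moreover have "- (\<Sum>a\<in>UNIV. \<bar>w u x $ a\<bar>) \<le> f u x"
      using component_le_LSE[OF \<beta>_pos, of "w u x" undefined] c[of undefined]
      by (simp add: lse_objective_def)
    moreover have "0 \<le> ln (real CARD('a)) / \<beta>" using \<beta>_pos by simp
    ultimately show ?thesis by linarith
  qed
  then show "AE x in P. norm (f u x) \<le> norm (?B x)"
    by (intro AE_I2) (metis abs_ge_self order_trans real_norm_def)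
qed

lemma f_has_gradient: "has_gradient M (\<lambda>v. f v x) (f_gradient u x) u"
proof (rule has_gradientI_quadratic)
  show "\<bar>f v x - f u x - (\<Sum>j\<in>{1..M}. f_gradient u x j * (v j - u j))\<bar>
     \<le> (2 * \<beta> * (opnorm x)\<^sup>2) * (distance v u)\<^sup>2" for v
    using f_expansion[of v x u] by simp
qed (simp add: f_gradient_def)

lemma f_gradient_eq: "j \<in> {1..M} \<Longrightarrow> f_gradient u x j = - (Chat x j \<bullet> gibbs u x)"
  by (simp add: f_gradient_def)

lemma F_gradient_eq: "j \<in> {1..M} \<Longrightarrow> F_gradient u j = (\<integral>x. f_gradient u x j \<partial>P)"
  by (simp add: f_gradient_eq F_gradient_def)

lemma integrable_f_gradient: "j \<in> {1..M} \<Longrightarrow> integrable P (\<lambda>x. f_gradient u x j)"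
  by (simp add: f_gradient_eq integrable_cost[OF simplex_valued_gibbs])

lemma F_has_gradient: "has_gradient M F (F_gradient u) u"
proof (rule has_gradientI_quadratic)
  fix v
  let ?R = "\<lambda>x. f v x - f u x - (\<Sum>j\<in>{1..M}. f_gradient u x j * (v j - u j))"
  have I: "integrable P (\<lambda>x. \<Sum>j\<in>{1..M}. f_gradient u x j * (v j - u j))"
    by (intro Bochner_Integration.integrable_sum integrable_mult_left integrable_f_gradient)
  have R: "integrable P ?R"
    by (intro Bochner_Integration.integrable_diff integrable_f I)
  have "(\<integral>x. ?R x \<partial>P) = F v - F u - (\<integral>x. (\<Sum>j\<in>{1..M}. f_gradient u x j * (v j - u j)) \<partial>P)"
    unfolding mean_objective_def
    by (simp only: Bochner_Integration.integral_diff integrable_f I Bochner_Integration.integrable_diff)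
  also have "(\<integral>x. (\<Sum>j\<in>{1..M}. f_gradient u x j * (v j - u j)) \<partial>P)
      = (\<Sum>j\<in>{1..M}. F_gradient u j * (v j - u j))"
    by (subst Bochner_Integration.integral_sum) (auto simp: F_gradient_eq integrable_f_gradient)
  finally have eq: "F v - F u - (\<Sum>j\<in>{1..M}. F_gradient u j * (v j - u j)) = (\<integral>x. ?R x \<partial>P)" by simp
  have "0 \<le> (\<integral>x. ?R x \<partial>P)" by (intro integral_nonneg_AE AE_I2 f_expansion)
  moreover have "(\<integral>x. ?R x \<partial>P) \<le> (\<integral>x. (2 * \<beta>) * (opnorm x)\<^sup>2 * (distance v u)\<^sup>2 \<partial>P)"
    by (intro integral_mono R f_expansion integrable_mult_left integrable_mult_right integrable_norm_sq)
  moreover have "\<dots> = (2 * \<beta> * \<sigma>\<^sup>2) * (distance v u)\<^sup>2" by (simp add: \<sigma>_sq)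
  ultimately show "\<bar>F v - F u - (\<Sum>j\<in>{1..M}. F_gradient u j * (v j - u j))\<bar>
      \<le> (2 * \<beta> * \<sigma>\<^sup>2) * (distance v u)\<^sup>2"
    unfolding eq by linarith
qed (simp add: F_gradient_def)

lemmas grad_F = grad_eq[OF _ F_has_gradient]
lemmas grad_f = grad_eq[OF _ f_has_gradient]

text \<open>Average the subgradient inequalities at the intermediate point; their linear terms cancel.\<close>

lemma f_convex:
  assumes "0 \<le> t" "t \<le> 1"
  shows "f (\<lambda>j\<in>{1..M}. (1 - t) * u j + t * v j) x \<le> (1 - t) * f u x + t * f v x"
proof -
  let ?z = "\<lambda>j\<in>{1..M}. (1 - t) * u j + t * v j"
  let ?g = "f_gradient ?z x"
  let ?s = "\<lambda>y. \<Sum>j\<in>{1..M}. ?g j * (y j - ?z j)"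
  have "(1 - t) * ?s u + t * ?s v = (\<Sum>j\<in>{1..M}. ?g j * ((1 - t) * (u j - ?z j) + t * (v j - ?z j)))"
    by (simp add: sum_distrib_left distrib_left mult.left_commute flip: sum.distrib)
  also have "\<dots> = 0"
    by (intro sum.neutral ballI) (simp add: algebra_simps)
  finally have "f ?z x = (1 - t) * (f ?z x + ?s u) + t * (f ?z x + ?s v)"
    by (simp add: algebra_simps)
  also have "\<dots> \<le> (1 - t) * f u x + t * f v x"
    using f_expansion(1)[of u x ?z] f_expansion(1)[of v x ?z] assms
    by (intro add_mono mult_left_mono) auto
  finally show ?thesis .
qed

text \<open>One factor \<open>opnorm x\<close> bounds the change of the scores, the other maps the resulting change of the
  softmax to a change of costs; the mean of their product is \<open>\<sigma>\<^sup>2\<close>.\<close>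

lemma F_gradient_Lipschitz:
  "L2_set (\<lambda>j. F_gradient u j - F_gradient v j) {1..M} \<le> (2 * \<beta> * \<sigma>\<^sup>2) * distance u v"
proof -
  note int = integrable_cost[OF simplex_valued_gibbs]
  have "L2_set (\<lambda>j. F_gradient u j - F_gradient v j) {1..M}
      = L2_set (\<lambda>j. \<integral>x. Chat x j \<bullet> (gibbs v x - gibbs u x) \<partial>P) {1..M}"
    by (rule L2_set_cong) (simp_all add: F_gradient_def inner_diff_right int)
  also have "\<dots> \<le> (\<integral>x. (2 * \<beta>) * (opnorm x)\<^sup>2 * distance u v \<partial>P)"
  proof (rule L2_set_integral_le)
    show "integrable P (\<lambda>x. Chat x j \<bullet> (gibbs v x - gibbs u x))" if "j \<in> {1..M}" for j
      using int[OF that] by (simp add: inner_diff_right)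
    show "integrable P (\<lambda>x. (2 * \<beta>) * (opnorm x)\<^sup>2 * distance u v)"
      by (intro integrable_mult_left integrable_mult_right integrable_norm_sq)
    fix x
    have sym: "distance v u = distance u v" by (simp add: L2_set_def power2_commute)
    have "L2_set (\<lambda>j. Chat x j \<bullet> (gibbs v x - gibbs u x)) {1..M}
        \<le> opnorm x * (2 * \<beta> * (opnorm x * distance v u))"
      by (rule order_trans[OF L2_set_le_norm_1_2 mult_left_mono[OF gibbs_l1_Lipschitz norm_1_2_nonneg]])
    then show "L2_set (\<lambda>j. Chat x j \<bullet> (gibbs v x - gibbs u x)) {1..M}
        \<le> (2 * \<beta>) * (opnorm x)\<^sup>2 * distance u v"
      unfolding sym by (simp add: power2_eq_square mult_ac)
  qed
  also have "\<dots> = (2 * \<beta> * \<sigma>\<^sup>2) * distance u v" by (simp add: \<sigma>_sq)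
  finally show ?thesis .
qed

text \<open>The variance of the sample gradient is at most its second moment, and the sample gradient is the
  image of a probability vector under \<open>Chat x\<close>.\<close>

lemma gradient_variance:
  "(\<integral>\<^sup>+x. ennreal ((L2_set (\<lambda>j. f_gradient u x j - F_gradient u j) {1..M})\<^sup>2) \<partial>P) \<le> ennreal (\<sigma>\<^sup>2)"
proof -
  let ?Y = "\<lambda>j x. f_gradient u x j"
  have L2: "L2_set (\<lambda>j. ?Y j x) {1..M} \<le> opnorm x" for x
  proof -
    have "L2_set (\<lambda>j. ?Y j x) {1..M} = L2_set (\<lambda>j. Chat x j \<bullet> gibbs u x) {1..M}"
      by (simp add: L2_set_def f_gradient_eq)
    also have "\<dots> \<le> opnorm x"
      by (rule norm_1_2_upper) (simp add: softmax_nonneg sum_softmax)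
    finally show ?thesis .
  qed
  have sum_le: "(\<Sum>j\<in>{1..M}. (?Y j x)\<^sup>2) \<le> (opnorm x)\<^sup>2" for x
    using power_mono[OF L2[of x], of 2] by (simp add: L2_set_def sum_nonneg)
  have Ysq: "integrable P (\<lambda>x. (?Y j x)\<^sup>2)" if j: "j \<in> {1..M}" for j
  proof (rule Bochner_Integration.integrable_bound[OF integrable_norm_sq])
    show "(\<lambda>x. (?Y j x)\<^sup>2) \<in> borel_measurable P"
      using integrable_f_gradient[OF j, of u] by measurable
    have "(?Y j x)\<^sup>2 \<le> (opnorm x)\<^sup>2" for x
      using member_le_sum[of j "{1..M}" "\<lambda>j. (?Y j x)\<^sup>2"] j sum_le[of x] by simp
    then show "AE x in P. norm ((?Y j x)\<^sup>2) \<le> norm ((opnorm x)\<^sup>2)" by simp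
  qed
  have Vint: "integrable P (\<lambda>x. (?Y j x - F_gradient u j)\<^sup>2)" if "j \<in> {1..M}" for j
    using integrable_f_gradient[OF that, of u] Ysq[OF that] by (simp add: power2_diff)
  have V: "(\<integral>x. (?Y j x - F_gradient u j)\<^sup>2 \<partial>P) \<le> (\<integral>x. (?Y j x)\<^sup>2 \<partial>P)" if "j \<in> {1..M}" for j
    using variance_eq[OF integrable_f_gradient[OF that] Ysq[OF that]] by (simp add: F_gradient_eq[OF that])
  have "(\<integral>\<^sup>+x. ennreal ((L2_set (\<lambda>j. ?Y j x - F_gradient u j) {1..M})\<^sup>2) \<partial>P)
      = ennreal (\<integral>x. (\<Sum>j\<in>{1..M}. (?Y j x - F_gradient u j)\<^sup>2) \<partial>P)"
    unfolding L2_set_def by (subst nn_integral_eq_integral[symmetric]) (auto intro!: Vint sum_nonneg simp: sum_nonneg)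
  also have "(\<integral>x. (\<Sum>j\<in>{1..M}. (?Y j x - F_gradient u j)\<^sup>2) \<partial>P)
      = (\<Sum>j\<in>{1..M}. \<integral>x. (?Y j x - F_gradient u j)\<^sup>2 \<partial>P)"
    by (intro Bochner_Integration.integral_sum Vint)
  also have "\<dots> \<le> (\<Sum>j\<in>{1..M}. \<integral>x. (?Y j x)\<^sup>2 \<partial>P)" by (intro sum_mono V)
  also have "\<dots> = (\<integral>x. (\<Sum>j\<in>{1..M}. (?Y j x)\<^sup>2) \<partial>P)"
    by (intro Bochner_Integration.integral_sum[symmetric] Ysq)
  also have "\<dots> \<le> \<sigma>\<^sup>2"
    unfolding \<sigma>_sq by (intro integral_mono sum_le integrable_norm_sq Bochner_Integration.integrable_sum Ysq)
  finally show ?thesis by (simp add: ennreal_leI)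
qed

lemma smooth_objective_lse: "smooth_objective M (2 * \<beta> * \<sigma>\<^sup>2) (\<sigma>\<^sup>2) P f"
  unfolding smooth_objective_def
proof (intro conjI ballI)
  fix u v x t assume "u \<in> orthant M" "v \<in> orthant M" "x \<in> space P" "t \<in> {0..1::real}"
  then show "f (\<lambda>j\<in>{1..M}. (1 - t) * u j + t * v j) x \<le> (1 - t) * f u x + t * f v x"
    by (intro f_convex) auto
next
  fix u assume u: "u \<in> orthant M"
  show "\<exists>g. has_gradient M (\<lambda>v. f v x) g u" for x using f_has_gradient by blast
  show "\<exists>g. has_gradient M F g u" using F_has_gradient by blast
  show "L2_set (\<lambda>j. grad M F u j - grad M F v j) {1..M} \<le> 2 * \<beta> * \<sigma>\<^sup>2 * distance u v"
    if "v \<in> orthant M" for v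
    unfolding grad_F[OF u] grad_F[OF that] by (rule F_gradient_Lipschitz)
  show "(\<integral>\<^sup>+x. ennreal ((L2_set (\<lambda>j. grad M (\<lambda>v. f v x) u j - grad M F u j) {1..M})\<^sup>2) \<partial>P)
      \<le> ennreal (\<sigma>\<^sup>2)"
    unfolding grad_F[OF u] grad_f[OF u] by (rule gradient_variance)
qed (rule prob_space_axioms integrable_f)+

section \<open>Violation and risk at a fixed multiplier\<close>

abbreviation G :: "real \<Rightarrow> (nat \<Rightarrow> real) \<Rightarrow> nat \<Rightarrow> real" where
  "G \<alpha> \<equiv> gradient_mapping M \<alpha> F"

lemma gradient_mapping_eq:
  "u \<in> orthant M \<Longrightarrow> j \<in> {1..M} \<Longrightarrow> G \<alpha> u j = (u j - max (u j - \<alpha> * F_gradient u j) 0) / \<alpha>"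
  by (simp add: gradient_mapping_def grad_F)

lemma measurable_gradient_mapping:
  "(\<lambda>u. L2_set (G \<alpha> u) {1..M}) \<in> borel_measurable (orthant_space M)"
proof -
  note [measurable] = measurable_mean_score[OF measurable_Chat]
  have "(\<lambda>u. (u j - max (u j - \<alpha> * F_gradient u j) 0) / \<alpha>) \<in> borel_measurable (orthant_space M)"
    if "j \<in> {1..M}" for j
  proof -
    have "(\<lambda>u. F_gradient u j) \<in> borel_measurable (orthant_space M)"
      using that by (simp add: F_gradient_def)
    then show ?thesis using measurable_orthant_coordinate[OF that] by measurable
  qed
  then have "(\<lambda>u. G \<alpha> u j) \<in> borel_measurable (orthant_space M)" if "j \<in> {1..M}" for j
    using that by (subst measurable_cong[where g = "\<lambda>u. (u j - max (u j - \<alpha> * F_gradient u j) 0) / \<alpha>"])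
      (auto simp: space_orthant_space gradient_mapping_eq)
  then show ?thesis unfolding L2_set_def by measurable
qed

lemma F_gradient_norm: "L2_set (F_gradient u) {1..M} \<le> \<sigma>"
  using L2_set_mean_Chat_le[OF simplex_valued_gibbs, of u]
  by (simp add: L2_set_def F_gradient_def)

text \<open>The estimated cost is the negative gradient, whose positive part the gradient mapping dominates;
  replacing estimated by true costs moves the cost vector by at most \<open>\<Delta>\<close>.\<close>

lemma constraint_violation:
  fixes C :: "'x \<Rightarrow> nat \<Rightarrow> real ^ 'a"
  assumes u: "u \<in> orthant M" and \<alpha>: "\<alpha> > 0"
    and C: "\<And>j a. j \<in> {1..M} \<Longrightarrow> (\<lambda>x. C x j $ a) \<in> borel_measurable P"
    and sq: "integrable P (\<lambda>x. (norm_1_2 M (\<lambda>j. C x j - Chat x j))\<^sup>2)"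
    and \<Delta>: "\<Delta> \<ge> 0" "\<Delta>\<^sup>2 = (\<integral>x. (norm_1_2 M (\<lambda>j. C x j - Chat x j))\<^sup>2 \<partial>P)"
  shows "L2_set (\<lambda>j. max (\<integral>x. C x j \<bullet> gibbs u x \<partial>P) 0) {1..M} \<le> L2_set (G \<alpha> u) {1..M} + \<Delta>"
proof -
  have D: "(\<lambda>x. (C x j - Chat x j) $ a) \<in> borel_measurable P" if "j \<in> {1..M}" for j a
    using C[OF that] measurable_Chat[OF that] by simp
  let ?d = "\<lambda>j. \<integral>x. (C x j - Chat x j) \<bullet> gibbs u x \<partial>P"
  have d: "L2_set ?d {1..M} \<le> \<Delta>"
    using L2_set_mean_cost_le[OF D sq simplex_valued_gibbs] \<Delta>(1) by (simp flip: \<Delta>(2))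
  have "max (\<integral>x. C x j \<bullet> gibbs u x \<partial>P) 0 \<le> \<bar>G \<alpha> u j\<bar> + \<bar>?d j\<bar>" if j: "j \<in> {1..M}" for j
  proof -
    have "0 \<le> u j" using u j by (auto simp: orthant_def)
    from neg_part_le_gradient_mapping[OF \<alpha> this, of "F_gradient u j"]
    have "(\<integral>x. Chat x j \<bullet> gibbs u x \<partial>P) \<le> \<bar>G \<alpha> u j\<bar>"
      using j by (simp add: gradient_mapping_eq[OF u] F_gradient_def)
    moreover have "integrable P (\<lambda>x. (C x j - Chat x j) \<bullet> gibbs u x)"
      using integrable_cost_entry[OF D sq j] by (rule integrable_inner_simplex[OF simplex_valued_gibbs])
    from Bochner_Integration.integral_add[OF this integrable_cost[OF simplex_valued_gibbs[of u] j]]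
    have "(\<integral>x. C x j \<bullet> gibbs u x \<partial>P) = ?d j + (\<integral>x. Chat x j \<bullet> gibbs u x \<partial>P)"
      by (simp add: inner_diff_left)
    ultimately show ?thesis by linarith
  qed
  then have "L2_set (\<lambda>j. max (\<integral>x. C x j \<bullet> gibbs u x \<partial>P) 0) {1..M}
      \<le> L2_set (\<lambda>j. \<bar>G \<alpha> u j\<bar> + \<bar>?d j\<bar>) {1..M}"
    by (intro L2_set_mono) auto
  also have "\<dots> \<le> L2_set (\<lambda>j. \<bar>G \<alpha> u j\<bar>) {1..M} + L2_set (\<lambda>j. \<bar>?d j\<bar>) {1..M}"
    by (rule L2_set_triangle_ineq)
  also have "\<dots> \<le> L2_set (G \<alpha> u) {1..M} + \<Delta>" using d by (simp add: L2_set_def)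
  finally show ?thesis .
qed

text \<open>Approximate complementary slackness: the Cauchy-Schwarz inequality applied to the coordinatewise
  bound, where the gradient contributes its norm, which is at most \<open>\<sigma>\<close>.\<close>

lemma complementarity_bound:
  assumes u: "u \<in> orthant M" and \<alpha>: "\<alpha> > 0"
  shows "(\<Sum>j\<in>{1..M}. u j * F_gradient u j) \<le> (L2_set u {1..M} + \<alpha> * \<sigma>) * L2_set (G \<alpha> u) {1..M}"
proof -
  have nonneg: "0 \<le> u j" if "j \<in> {1..M}" for j using u that by (auto simp: orthant_def)
  have "(\<Sum>j\<in>{1..M}. u j * F_gradient u j)
      \<le> (\<Sum>j\<in>{1..M}. \<bar>u j + \<alpha> * \<bar>F_gradient u j\<bar>\<bar> * \<bar>G \<alpha> u j\<bar>)"
  proof (rule sum_mono)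
    fix j assume j: "j \<in> {1..M}"
    show "u j * F_gradient u j \<le> \<bar>u j + \<alpha> * \<bar>F_gradient u j\<bar>\<bar> * \<bar>G \<alpha> u j\<bar>"
      using complementarity_gradient_mapping[OF \<alpha> nonneg[OF j], of "F_gradient u j"] nonneg[OF j] \<alpha>
      by (simp add: gradient_mapping_eq[OF u j])
  qed
  also have "\<dots> \<le> L2_set (\<lambda>j. u j + \<alpha> * \<bar>F_gradient u j\<bar>) {1..M} * L2_set (G \<alpha> u) {1..M}"
    by (rule L2_set_mult_ineq)
  also have "\<dots> \<le> (L2_set u {1..M} + \<alpha> * \<sigma>) * L2_set (G \<alpha> u) {1..M}"
  proof (rule mult_right_mono)
    have "L2_set (\<lambda>j. u j + \<alpha> * \<bar>F_gradient u j\<bar>) {1..M}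
        \<le> L2_set u {1..M} + L2_set (\<lambda>j. \<alpha> * \<bar>F_gradient u j\<bar>) {1..M}"
      by (rule L2_set_triangle_ineq)
    also have "L2_set (\<lambda>j. \<alpha> * \<bar>F_gradient u j\<bar>) {1..M} = \<alpha> * L2_set (F_gradient u) {1..M}"
      using \<alpha> by (subst L2_set_right_distrib) (simp_all add: L2_set_def power_mult_distrib)
    also have "\<dots> \<le> \<alpha> * \<sigma>" using \<alpha> F_gradient_norm by simp
    finally show "L2_set (\<lambda>j. u j + \<alpha> * \<bar>F_gradient u j\<bar>) {1..M} \<le> L2_set u {1..M} + \<alpha> * \<sigma>" by simp
  qed simp
  finally show ?thesis .
qed

text \<open>Duality of the maximum norm with the l1 norm, in which probability vectors have norm one.\<close>

lemma mean_loss_perturbation: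
  fixes l :: "'x \<Rightarrow> real ^ 'a"
  assumes l: "\<And>a. integrable P (\<lambda>x. l x $ a)"
    and inf: "integrable P (\<lambda>x. infnorm (l x - Lhat x))" and q: "simplex_valued P q"
  shows "\<bar>(\<integral>x. l x \<bullet> q x \<partial>P) - (\<integral>x. Lhat x \<bullet> q x \<partial>P)\<bar> \<le> (\<integral>x. infnorm (l x - Lhat x) \<partial>P)"
proof -
  have i: "integrable P (\<lambda>x. l x \<bullet> q x)" "integrable P (\<lambda>x. Lhat x \<bullet> q x)"
    by (intro integrable_inner_simplex[OF q] l integrable_Lhat)+
  have "(\<integral>x. l x \<bullet> q x \<partial>P) - (\<integral>x. Lhat x \<bullet> q x \<partial>P) = (\<integral>x. (l x - Lhat x) \<bullet> q x \<partial>P)"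
    using i by (simp add: inner_diff_left)
  also have "\<bar>\<dots>\<bar> \<le> (\<integral>x. \<bar>(l x - Lhat x) \<bullet> q x\<bar> \<partial>P)" by (rule integral_abs_bound)
  also have "\<dots> \<le> (\<integral>x. infnorm (l x - Lhat x) \<partial>P)"
  proof (rule integral_mono[OF _ inf])
    show "integrable P (\<lambda>x. \<bar>(l x - Lhat x) \<bullet> q x\<bar>)"
      using i by (simp add: inner_diff_left)
    show "\<bar>(l x - Lhat x) \<bullet> q x\<bar> \<le> infnorm (l x - Lhat x)" if "x \<in> space P" for x
      using simplex_valuedD(2,3)[OF q that] by (intro simplex_inner_bounds component_le_infnorm_cart)
  qed
  finally show ?thesis .
qed

text \<open>The Gibbs classifier almost minimises the estimated Lagrangian at \<open>u\<close>.  Comparing with a feasible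
  \<open>q\<close>, whose estimated costs weighted by \<open>u\<close> are at most \<open>\<Delta> \<parallel>u\<parallel>\<close>, leaves the term
  \<open>\<Sum>j. u j * F_gradient u j\<close>, which approximate complementary slackness controls.\<close>

lemma risk_bound:
  fixes C :: "'x \<Rightarrow> nat \<Rightarrow> real ^ 'a" and l :: "'x \<Rightarrow> real ^ 'a"
  assumes u: "u \<in> orthant M" and \<alpha>: "\<alpha> > 0"
    and C: "\<And>j a. j \<in> {1..M} \<Longrightarrow> (\<lambda>x. C x j $ a) \<in> borel_measurable P"
    and sq: "integrable P (\<lambda>x. (norm_1_2 M (\<lambda>j. C x j - Chat x j))\<^sup>2)"
    and \<Delta>: "\<Delta> \<ge> 0" "\<Delta>\<^sup>2 = (\<integral>x. (norm_1_2 M (\<lambda>j. C x j - Chat x j))\<^sup>2 \<partial>P)"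
    and l: "\<And>a. integrable P (\<lambda>x. l x $ a)" and inf: "integrable P (\<lambda>x. infnorm (l x - Lhat x))"
    and q: "simplex_valued P q" and feasible: "\<And>j. j \<in> {1..M} \<Longrightarrow> (\<integral>x. C x j \<bullet> q x \<partial>P) \<le> 0"
  shows "(\<integral>x. l x \<bullet> gibbs u x \<partial>P) \<le> (\<integral>x. l x \<bullet> q x \<partial>P)
    + (L2_set u {1..M} + \<alpha> * \<sigma>) * L2_set (G \<alpha> u) {1..M}
    + 2 * (\<integral>x. infnorm (l x - Lhat x) \<partial>P) + \<Delta> * L2_set u {1..M} + ln (real CARD('a)) / \<beta>"
proof -
  have nonneg: "0 \<le> u j" if "j \<in> {1..M}" for j using u that by (auto simp: orthant_def)
  have D: "(\<lambda>x. (C x j - Chat x j) $ a) \<in> borel_measurable P" if "j \<in> {1..M}" for j a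
    using C[OF that] measurable_Chat[OF that] by simp
  \<comment> \<open>\<open>lag q\<close> is the estimated Lagrangian density at the multiplier \<open>u\<close>, namely \<open>- q \<bullet> w u\<close>.\<close>
  define lag where "lag q x = Lhat x \<bullet> q x + (\<Sum>j\<in>{1..M}. u j * (Chat x j \<bullet> q x))" for q x
  have lag_int: "integrable P (lag q)" if "simplex_valued P q" for q
    unfolding lag_def using integrable_inner_simplex[OF that integrable_Lhat] integrable_cost[OF that]
    by (auto intro!: Bochner_Integration.integrable_add Bochner_Integration.integrable_sum)
  have lag_mean: "(\<integral>x. lag q x \<partial>P)
      = (\<integral>x. Lhat x \<bullet> q x \<partial>P) + (\<Sum>j\<in>{1..M}. u j * (\<integral>x. Chat x j \<bullet> q x \<partial>P))"
    if q: "simplex_valued P q" for q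
  proof -
    have "integrable P (\<lambda>x. u j * (Chat x j \<bullet> q x))" if "j \<in> {1..M}" for j
      using integrable_cost[OF q that] by simp
    then show ?thesis
      unfolding lag_def using integrable_inner_simplex[OF q integrable_Lhat]
      by (subst Bochner_Integration.integral_add)
        (auto simp: Bochner_Integration.integral_sum intro!: Bochner_Integration.integrable_sum)
  qed
  have "(\<integral>x. lag (gibbs u) x \<partial>P) \<le> (\<integral>x. lag q x + ln (real CARD('a)) / \<beta> \<partial>P)"
  proof (rule integral_mono)
    fix x assume x: "x \<in> space P"
    have "q x \<bullet> w u x \<le> gibbs u x \<bullet> w u x + ln (real CARD('a)) / \<beta>"
      using simplex_valuedD(2,3)[OF q x] by (intro softmax_almost_maximal \<beta>_pos)
    then show "lag (gibbs u) x \<le> lag q x + ln (real CARD('a)) / \<beta>"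
      by (simp add: inner_neg_lagrangian lag_def)
  qed (auto intro!: lag_int q simplex_valued_gibbs)
  also have "\<dots> = (\<integral>x. lag q x \<partial>P) + ln (real CARD('a)) / \<beta>"
    using lag_int[OF q] by (simp add: prob_space)
  finally have lag_le: "(\<integral>x. lag (gibbs u) x \<partial>P) \<le> (\<integral>x. lag q x \<partial>P) + ln (real CARD('a)) / \<beta>" .
  let ?d = "\<lambda>j. \<integral>x. (C x j - Chat x j) \<bullet> q x \<partial>P"
  have "(\<Sum>j\<in>{1..M}. u j * (\<integral>x. Chat x j \<bullet> q x \<partial>P)) \<le> (\<Sum>j\<in>{1..M}. \<bar>u j\<bar> * \<bar>?d j\<bar>)"
  proof (rule sum_mono)
    fix j assume j: "j \<in> {1..M}"
    have "integrable P (\<lambda>x. (C x j - Chat x j) \<bullet> q x)"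
      using integrable_cost_entry[OF D sq j] by (rule integrable_inner_simplex[OF q])
    from Bochner_Integration.integral_add[OF this integrable_cost[OF q j]]
    have "(\<integral>x. C x j \<bullet> q x \<partial>P) = ?d j + (\<integral>x. Chat x j \<bullet> q x \<partial>P)"
      by (simp add: inner_diff_left)
    then have "(\<integral>x. Chat x j \<bullet> q x \<partial>P) \<le> \<bar>?d j\<bar>" using feasible[OF j] by linarith
    then show "u j * (\<integral>x. Chat x j \<bullet> q x \<partial>P) \<le> \<bar>u j\<bar> * \<bar>?d j\<bar>"
      using nonneg[OF j] by (simp add: mult_left_mono)
  qed
  also have "\<dots> \<le> L2_set u {1..M} * L2_set ?d {1..M}" by (rule L2_set_mult_ineq)
  also have "\<dots> \<le> L2_set u {1..M} * \<Delta>"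
    using L2_set_mean_cost_le[OF D sq q] \<Delta>(1) by (intro mult_left_mono) (simp_all flip: \<Delta>(2))
  finally have "(\<Sum>j\<in>{1..M}. u j * (\<integral>x. Chat x j \<bullet> q x \<partial>P)) \<le> \<Delta> * L2_set u {1..M}"
    by (simp add: mult.commute)
  moreover have "(\<Sum>j\<in>{1..M}. u j * F_gradient u j)
      = - (\<Sum>j\<in>{1..M}. u j * (\<integral>x. Chat x j \<bullet> gibbs u x \<partial>P))"
    by (simp add: F_gradient_def flip: sum_negf)
  moreover note lag_le lag_mean[OF q] lag_mean[OF simplex_valued_gibbs[of u]] complementarity_bound[OF u \<alpha>]
    mean_loss_perturbation[OF l inf q] mean_loss_perturbation[OF l inf simplex_valued_gibbs[of u]]
  ultimately show ?thesis by linarith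
qed


section \<open>Averaging over the output of the optimizer\<close>

text \<open>The guarantee of an optimizer is a nonnegative integral; as the gradient mapping is measurable in
  the multiplier, it yields square integrability under the law \<open>Q\<close> of the output.\<close>

lemma gradient_mapping_moments:
  assumes Q: "sets Q = sets (orthant_space M)"
    and bound: "(\<integral>\<^sup>+u. ennreal ((L2_set (G \<alpha> u) {1..M})\<^sup>2) \<partial>Q) \<le> ennreal (\<psi>\<^sup>2)" and \<psi>: "\<psi> \<ge> 0"
  shows measurable_norm_G: "(\<lambda>u. L2_set (G \<alpha> u) {1..M}) \<in> borel_measurable Q"
    and integrable_norm_G_sq: "integrable Q (\<lambda>u. (L2_set (G \<alpha> u) {1..M})\<^sup>2)"
    and norm_G_le: "sqrt (\<integral>u. (L2_set (G \<alpha> u) {1..M})\<^sup>2 \<partial>Q) \<le> \<psi>"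
proof -
  show meas: "(\<lambda>u. L2_set (G \<alpha> u) {1..M}) \<in> borel_measurable Q"
    using measurable_gradient_mapping by (simp add: measurable_cong_sets[OF Q refl])
  show sq: "integrable Q (\<lambda>u. (L2_set (G \<alpha> u) {1..M})\<^sup>2)"
    using bound meas by (intro integrableI_bounded) (auto intro: le_less_trans)
  have "ennreal (\<integral>u. (L2_set (G \<alpha> u) {1..M})\<^sup>2 \<partial>Q) \<le> ennreal (\<psi>\<^sup>2)"
    using bound by (subst nn_integral_eq_integral[OF sq, symmetric]) auto
  then have "(\<integral>u. (L2_set (G \<alpha> u) {1..M})\<^sup>2 \<partial>Q) \<le> \<psi>\<^sup>2" by simp
  then show "sqrt (\<integral>u. (L2_set (G \<alpha> u) {1..M})\<^sup>2 \<partial>Q) \<le> \<psi>"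
    using \<psi> by (rule real_le_lsqrt[rotated])
qed

end

lemma output_law_space:
  assumes "prob_space P" "opt \<in> (\<Pi>\<^sub>M i\<in>{1..T}. P) \<rightarrow>\<^sub>M prob_algebra N"
  shows prob_space_output_law: "prob_space (output_law P T opt)"
    and sets_output_law: "sets (output_law P T opt) = sets N"
proof -
  have sample: "(\<Pi>\<^sub>M i\<in>{1..T}. P) \<in> space (prob_algebra (\<Pi>\<^sub>M i\<in>{1..T}. P))"
    using assms(1) by (simp add: space_prob_algebra prob_space_PiM)
  show "prob_space (output_law P T opt)" "sets (output_law P T opt) = sets N"
    unfolding output_law_def
    by (rule prob_space_bind'[OF sample assms(2)] sets_bind'[OF sample assms(2)])+
qed

lemma borel_measurable_vec_component:
  "h \<in> borel_measurable P \<Longrightarrow> (\<lambda>x. (h x :: real ^ 'a::finite) $ a) \<in> borel_measurable P"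
  by (rule measurable_compose[OF _ borel_measurable_continuous_onI]) (auto intro!: continuous_intros)

theorem corollary4p5:
  fixes P :: "'x measure"
    and M T :: nat
    and loss :: "'x \<Rightarrow> 'a :: finite \<Rightarrow> real"
    and c :: "nat \<Rightarrow> 'x \<Rightarrow> 'a \<Rightarrow> real"
    and Lvec Lhat :: "'x \<Rightarrow> real ^ 'a"
    and Cmat Chat :: "'x \<Rightarrow> nat \<Rightarrow> real ^ 'a"
    and \<beta> \<alpha> \<sigma> L \<Delta>loss \<Delta>constr :: real
    and \<Psi> :: "real \<Rightarrow> nat \<Rightarrow> real \<Rightarrow> real \<Rightarrow> real"
    and opt :: "(nat \<Rightarrow> 'x) \<Rightarrow> (nat \<Rightarrow> real) measure"
  assumes "prob_space P"
    and "\<And>x. Lvec x = (\<chi> a. loss x a)"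
    and "\<And>x j. Cmat x j = (\<chi> a. c j x a)"
    and "\<And>a. integrable P (\<lambda>x. loss x a)"
    and "\<And>j a. j \<in> {1..M} \<Longrightarrow> (\<lambda>x. c j x a) \<in> borel_measurable P"
    and "Lhat \<in> borel_measurable P"
    and "\<And>j. j \<in> {1..M} \<Longrightarrow> (\<lambda>x. Chat x j) \<in> borel_measurable P"
    and "integrable P (\<lambda>x. infnorm (Lvec x - Lhat x))"
    and "\<Delta>loss = (\<integral>x. infnorm (Lvec x - Lhat x) \<partial>P)"
    and "integrable P (\<lambda>x. (norm_1_2 M (\<lambda>j. Cmat x j - Chat x j))\<^sup>2)"
    and "\<Delta>constr \<ge> 0"
    and "\<Delta>constr\<^sup>2 = (\<integral>x. (norm_1_2 M (\<lambda>j. Cmat x j - Chat x j))\<^sup>2 \<partial>P)"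
    and "integrable P (\<lambda>x. (norm_1_2 M (Chat x))\<^sup>2)"
    and "\<sigma> \<ge> 0"
    and "\<sigma>\<^sup>2 = (\<integral>x. (norm_1_2 M (Chat x))\<^sup>2 \<partial>P)"
    and "\<beta> > 0"
    and "L = 2 * \<beta> * \<sigma>\<^sup>2"
    and "T \<ge> 1"
    and "black_box_optimizer M P (lse_objective M \<beta> Lhat Chat) (\<sigma>\<^sup>2) L T \<alpha> \<Psi> opt"
  shows
    "(integrable (output_law P T opt)
        (\<lambda>u. sqrt (\<Sum>j\<in>{1..M}. (max (expected_score P (c j) (gibbs_classifier M \<beta> Lhat Chat u)) 0)\<^sup>2)) \<and>
      (\<integral>u. sqrt (\<Sum>j\<in>{1..M}. (max (expected_score P (c j) (gibbs_classifier M \<beta> Lhat Chat u)) 0)\<^sup>2)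
         \<partial>output_law P T opt)
       \<le> \<Psi> \<alpha> T (\<sigma>\<^sup>2) L + \<Delta>constr) \<and>
     (integrable (output_law P T opt) (\<lambda>u. (L2_set u {1..M} + \<alpha> * \<sigma>)\<^sup>2) \<longrightarrow>
      (\<forall>\<pi>. randomized_classifier P \<pi> \<and> (\<forall>j\<in>{1..M}. expected_score P (c j) \<pi> \<le> 0) \<longrightarrow>
        integrable (output_law P T opt)
          (\<lambda>u. expected_score P loss (gibbs_classifier M \<beta> Lhat Chat u)) \<and>
        (\<integral>u. expected_score P loss (gibbs_classifier M \<beta> Lhat Chat u) \<partial>output_law P T opt)
          \<le> expected_score P loss \<pi>
             + sqrt (\<integral>u. (L2_set u {1..M} + \<alpha> * \<sigma>)\<^sup>2 \<partial>output_law P T opt) * \<Psi> \<alpha> T (\<sigma>\<^sup>2) L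
             + 2 * (\<integral>u. \<Delta>loss \<partial>output_law P T opt)
             + (\<integral>u. \<Delta>constr * L2_set u {1..M} \<partial>output_law P T opt)
             + 2 * ln (real CARD('a)) / \<beta>))"
proof -
  note P = assms(1) and C_eq = assms(3) and loss = assms(4) and inf = assms(8)
    and sq = assms(10) and \<Delta> = assms(11,12) and L_eq = assms(17)
  interpret P: prob_space P by (rule P)
  have Chat: "(\<lambda>x. Chat x j $ a) \<in> borel_measurable P" if "j \<in> {1..M}" for j a
    by (rule borel_measurable_vec_component[OF assms(7)[OF that]])
  have C: "(\<lambda>x. Cmat x j $ a) \<in> borel_measurable P" if "j \<in> {1..M}" for j a
    using assms(5)[OF that] by (simp add: C_eq)
  have l: "integrable P (\<lambda>x. Lvec x $ a)" for a
    using loss by (simp add: assms(2))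
  \<comment> \<open>The estimated loss inherits integrability from the true loss and the estimation error.\<close>
  have Lhat: "integrable P (\<lambda>x. Lhat x $ a)" for a
  proof -
    have "integrable P (\<lambda>x. (Lvec x - Lhat x) $ a)"
    proof (rule Bochner_Integration.integrable_bound[OF inf])
      show "(\<lambda>x. (Lvec x - Lhat x) $ a) \<in> borel_measurable P"
        using borel_measurable_integrable[OF l] borel_measurable_vec_component[OF assms(6)] by simp
      show "AE x in P. norm ((Lvec x - Lhat x) $ a) \<le> norm (infnorm (Lvec x - Lhat x))"
        using component_le_infnorm_cart[of "Lvec x - Lhat x" a for x] by (simp add: infnorm_pos_le)
    qed
    from Bochner_Integration.integrable_diff[OF l[of a] this] show ?thesis by simp
  qed
  interpret estimated_problem P M \<beta> \<sigma> Lhat Chat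
    by unfold_locales (use assms Lhat Chat in auto)
  define Q where "Q = output_law P T opt"
  define \<psi> where "\<psi> = \<Psi> \<alpha> T (\<sigma>\<^sup>2) L"
  define N where "N u = L2_set (G \<alpha> u) {1..M}" for u
  have opt: "opt \<in> (\<Pi>\<^sub>M i\<in>{1..T}. P) \<rightarrow>\<^sub>M prob_algebra (orthant_space M)"
    and \<alpha>: "\<alpha> > 0" and \<psi>: "\<psi> \<ge> 0"
    and bound: "(\<integral>\<^sup>+u. ennreal ((L2_set (G \<alpha> u) {1..M})\<^sup>2) \<partial>Q) \<le> ennreal (\<psi>\<^sup>2)"
    using assms(19) smooth_objective_lse unfolding black_box_optimizer_def L_eq Q_def \<psi>_def by auto
  interpret Q: prob_space Q
    unfolding Q_def by (rule prob_space_output_law[OF P opt])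
  have sets: "sets Q = sets (orthant_space M)"
    unfolding Q_def by (rule sets_output_law[OF P opt])
  have space: "u \<in> orthant M" if "u \<in> space Q" for u
    using that sets_eq_imp_space_eq[OF sets] by (simp add: space_orthant_space)
  have meas: "g \<in> borel_measurable Q" if "g \<in> borel_measurable (orthant_space M)" for g :: "_ \<Rightarrow> real"
    using that by (simp add: measurable_cong_sets[OF sets refl])
  note moments = gradient_mapping_moments[OF sets bound \<psi>, folded N_def]
  have N: "integrable Q N"
    using Q.square_integrable_imp_integrable[OF moments(1,2)] .
  have score: "expected_score P h (gibbs_classifier M \<beta> Lhat Chat u) = (\<integral>x. (\<chi> a. h x a) \<bullet> gibbs u x \<partial>P)"
    for h u by (simp add: expected_score_eq prob_vector_gibbs_classifier)
  define V where "V u = L2_set (\<lambda>j. max (\<integral>x. Cmat x j \<bullet> gibbs u x \<partial>P) 0) {1..M}" for u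
  have V_eq: "sqrt (\<Sum>j\<in>{1..M}. (max (expected_score P (c j) (gibbs_classifier M \<beta> Lhat Chat u)) 0)\<^sup>2) = V u" for u
    by (simp add: V_def L2_set_def score C_eq)
  have V_le: "V u \<le> N u + \<Delta>constr" if "u \<in> space Q" for u
    unfolding V_def N_def by (rule constraint_violation[OF space[OF that] \<alpha> C sq \<Delta>])
  have V: "integrable Q V"
  proof (rule Bochner_Integration.integrable_bound)
    show "integrable Q (\<lambda>u. N u + \<Delta>constr)" using N by simp
    have "(\<lambda>u. max (\<integral>x. Cmat x j \<bullet> gibbs u x \<partial>P) 0) \<in> borel_measurable Q" if "j \<in> {1..M}" for j
      using meas[OF measurable_mean_score[OF C[OF that]]] by measurable
    then show "V \<in> borel_measurable Q" unfolding V_def L2_set_def by measurable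
    show "AE u in Q. norm (V u) \<le> norm (N u + \<Delta>constr)"
    proof (rule AE_I2)
      fix u assume "u \<in> space Q"
      moreover have "0 \<le> V u" by (simp add: V_def)
      ultimately show "norm (V u) \<le> norm (N u + \<Delta>constr)" using V_le[of u] by simp
    qed
  qed
  have "(\<integral>u. V u \<partial>Q) \<le> (\<integral>u. N u + \<Delta>constr \<partial>Q)"
    using V N V_le by (intro integral_mono) auto
  also have "\<dots> = (\<integral>u. N u \<partial>Q) + \<Delta>constr" using N by (simp add: Q.prob_space)
  also have "\<dots> \<le> \<psi> + \<Delta>constr"
    using Q.expectation_le_sqrt_square[OF moments(1,2)] moments(3) by simp
  finally have violation: "(\<integral>u. V u \<partial>Q) \<le> \<psi> + \<Delta>constr" .
  define R where "R u = (\<integral>x. Lvec x \<bullet> gibbs u x \<partial>P)" for u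
  have R_eq: "expected_score P loss (gibbs_classifier M \<beta> Lhat Chat u) = R u" for u
    by (simp add: R_def score assms(2))
  \<comment> \<open>Uniformly in the multiplier, the risk is at most the mean l1 norm of the loss vector.\<close>
  have R: "integrable Q R"
  proof (rule Q.integrable_const_bound)
    show "R \<in> borel_measurable Q"
      unfolding R_def by (rule meas[OF measurable_mean_score[OF borel_measurable_integrable[OF l]]])
    have "\<bar>R u\<bar> \<le> (\<integral>x. (\<Sum>a\<in>UNIV. \<bar>Lvec x $ a\<bar>) \<partial>P)" for u
    proof -
      have "\<bar>R u\<bar> \<le> (\<integral>x. \<bar>Lvec x \<bullet> gibbs u x\<bar> \<partial>P)"
        unfolding R_def by (rule integral_abs_bound)
      also have "\<dots> \<le> (\<integral>x. (\<Sum>a\<in>UNIV. \<bar>Lvec x $ a\<bar>) \<partial>P)"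
        by (intro integral_mono integrable_abs integrable_inner_simplex simplex_valued_gibbs l
            Bochner_Integration.integrable_sum simplex_inner_bounds softmax_nonneg sum_softmax)
          (auto intro: member_le_sum)
      finally show ?thesis .
    qed
    then show "AE u in Q. norm (R u) \<le> (\<integral>x. (\<Sum>a\<in>UNIV. \<bar>Lvec x $ a\<bar>) \<partial>P)" by simp
  qed
  have risk: "(\<integral>u. R u \<partial>Q) \<le> expected_score P loss \<pi>
        + sqrt (\<integral>u. (L2_set u {1..M} + \<alpha> * \<sigma>)\<^sup>2 \<partial>Q) * \<psi> + 2 * (\<integral>u. \<Delta>loss \<partial>Q)
        + (\<integral>u. \<Delta>constr * L2_set u {1..M} \<partial>Q) + 2 * ln (real CARD('a)) / \<beta>"
    if A2: "integrable Q (\<lambda>u. (L2_set u {1..M} + \<alpha> * \<sigma>)\<^sup>2)"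
      and \<pi>: "randomized_classifier P \<pi>" "\<forall>j\<in>{1..M}. expected_score P (c j) \<pi> \<le> 0" for \<pi>
  proof -
    define A where "A u = L2_set u {1..M} + \<alpha> * \<sigma>" for u
    have norm_meas: "(\<lambda>u. L2_set u {1..M}) \<in> borel_measurable Q"
      unfolding L2_set_def using meas[OF measurable_orthant_coordinate] by measurable
    have A: "A \<in> borel_measurable Q" unfolding A_def using norm_meas by measurable
    have A2': "integrable Q (\<lambda>u. (A u)\<^sup>2)" using A2 by (simp add: A_def)
    \<comment> \<open>\<open>L2_set u {1..M}\<close> is \<open>A u\<close> minus a constant, and \<open>A\<close> is square integrable.\<close>
    have norm_int: "integrable Q (\<lambda>u. L2_set u {1..M})"
      using Bochner_Integration.integrable_diff[OF
          Q.square_integrable_imp_integrable[OF A A2'] Q.integrable_const[of "\<alpha> * \<sigma>"]]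
      by (simp add: A_def)
    \<comment> \<open>The part of the pointwise risk bound that does not depend on the multiplier.\<close>
    let ?k = "expected_score P loss \<pi> + 2 * \<Delta>loss + ln (real CARD('a)) / \<beta>"
    have feasible: "(\<integral>x. Cmat x j \<bullet> prob_vector \<pi> x \<partial>P) \<le> 0" if "j \<in> {1..M}" for j
      using \<pi>(2) that by (simp add: expected_score_eq C_eq)
    have R_le: "R u \<le> A u * N u + \<Delta>constr * L2_set u {1..M} + ?k" if "u \<in> space Q" for u
      using risk_bound[OF space[OF that] \<alpha> C sq \<Delta> l inf simplex_valued_randomized_classifier[OF \<pi>(1)] feasible]
      by (simp add: R_def A_def N_def assms(9) expected_score_eq flip: assms(2))
    have AN: "integrable Q (\<lambda>u. A u * N u)"
      by (rule integrable_mult_of_squares[OF A moments(1) A2' moments(2)])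
    have "(\<integral>u. R u \<partial>Q) \<le> (\<integral>u. A u * N u + \<Delta>constr * L2_set u {1..M} + ?k \<partial>Q)"
      using R AN norm_int R_le by (intro integral_mono) auto
    also have "\<dots> = (\<integral>u. A u * N u \<partial>Q) + (\<integral>u. \<Delta>constr * L2_set u {1..M} \<partial>Q) + ?k"
      using AN norm_int by (simp add: Q.prob_space)
    also have "(\<integral>u. A u * N u \<partial>Q) \<le> sqrt (\<integral>u. (A u)\<^sup>2 \<partial>Q) * \<psi>"
      by (rule order_trans[OF integral_mult_le_sqrt[OF A moments(1) A2' moments(2)]])
        (intro mult_left_mono moments(3), simp)
    finally have "(\<integral>u. R u \<partial>Q) \<le> sqrt (\<integral>u. (A u)\<^sup>2 \<partial>Q) * \<psi> + (\<integral>u. \<Delta>constr * L2_set u {1..M} \<partial>Q) + ?k"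
      by simp
    moreover have "ln (real CARD('a)) / \<beta> \<le> 2 * ln (real CARD('a)) / \<beta>"
      using \<beta>_pos by (intro divide_right_mono) auto
    moreover have "(\<integral>u. \<Delta>loss \<partial>Q) = \<Delta>loss" by (simp add: Q.prob_space)
    ultimately show ?thesis unfolding A_def by linarith
  qed
  show ?thesis
    using V violation R risk unfolding V_eq R_eq Q_def \<psi>_def by blast
qed

end
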